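(* Let $f:\mathbb{R}\to\mathbb{R}$ be a function. Then $f$ is $\mathsf{ITBM}$-computable if and only if $f$ is $\mathsf{WITBM}$-computable.
   Context: A BSS-program is a finite numbered list of instructions acting on registers $R_1,\dots,R_n$ that contain real numbers; each instruction either replaces the content of a register by the value of a rational function, with rational coefficients, of the register contents, or performs a conditional jump depending on the register contents (e.g. "if $R_i>0$ go to line $k$, else go to line $l$"). The machines below run BSS-programs for transfinite ordinal time. At time $\alpha$ the snapshot is $C_\alpha=(R_1(\alpha),\dots,R_n(\alpha),I(\alpha))$, where $R_i(\alpha)\in\mathbb{R}$ is the content of register $R_i$ and $I(\alpha)$ is the program counter. At successor times the machine performs the current instruction as usual; it halts when the program counter points to no instruction. At a limit time $\lambda$, $I(\lambda)=\liminf_{\alpha<\lambda}I(\alpha)$, and $R_i(\lambda)$ is determined from the sequence $R_i^\lambda=(R_i(\alpha))_{\alpha<\lambda}$ by the limit rule of the model. If some $R_i(\lambda)$ is not defined, the machine crashes and the computation is considered divergent. For a sequence $f:\lambda\to\mathbb{R}$: a real $\ell$ is a finite limit point if for all $\beta<\lambda$ and $\varepsilon>0$ there is $\beta<\gamma<\lambda$ with $|f(\gamma)-\ell|<\varepsilon$; $+\infty$ (resp. $-\infty$) is an infinite strong limit point if for every $x\in\mathbb{R}$ there is $\beta<\lambda$ with $f(\gamma)>x$ (resp. $f(\gamma)<x$) for all $\beta<\gamma<\lambda$. $\mathrm{sLimP}(f)\subseteq\mathbb{R}\cup\{\pm\infty\}$ is the set of finite limit points and infinite strong limit points of $f$. Limit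 rules. $\mathsf{ITBM}$: $R_i(\lambda)$ is the (Cauchy) limit in $\mathbb{R}$ of $R_i^\lambda$ if it exists, and is undefined otherwise. $\mathsf{WITBM}$: $R_i(\lambda)=\ell$ if $R_i^\lambda$ is Cauchy with limit $\ell\in\mathbb{R}$; $R_i(\lambda)=0$ if $\min(\mathrm{sLimP}(R_i^\lambda))$ is an infinite strong limit; undefined otherwise. For either model $\Gamma$, $f:\mathbb{R}\to\mathbb{R}$ is $\Gamma$-computable if there is a BSS-program whose $\Gamma$-computation on input $x$ (in $R_1$, the other registers being $0$) halts with output $f(x)$ (in $R_1$) for every $x\in\mathbb{R}$. *)

theory Defs
  imports "HOL-Analysis.Analysis"
begin

text \<open>
  Polynomials with rational coefficients in the register contents are given by the expressions
  denoting them.  Registers are indexed by natural numbers, index 0 being the input/output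
  register \<open>R\<^sub>1\<close>.  A program mentions only finitely many registers; all others keep the value 0
  during the whole computation (both limit rules below send a constant sequence to its value),
  so no bound on the register indices has to be carried along.
\<close>

datatype poly_expr =
    Const rat
  | Reg nat
  | Add poly_expr poly_expr
  | Mult poly_expr poly_expr

primrec poly_val :: "poly_expr \<Rightarrow> (nat \<Rightarrow> real) \<Rightarrow> real" where
  "poly_val (Const c) R = of_rat c"
| "poly_val (Reg i) R = R i"
| "poly_val (Add p q) R = poly_val p R + poly_val q R"
| "poly_val (Mult p q) R = poly_val p R * poly_val q R"

text \<open>
  \<open>Assign i p q\<close> is \<open>R\<^sub>i := p/q\<close>; \<open>Branch i k l\<close> is ``if \<open>R\<^sub>i > 0\<close> go to line \<open>k\<close>, else go to
  line \<open>l\<close>''.  Lines are numbered from 0; a line number \<open>\<ge> length P\<close> points to no instruction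
  of \<open>P\<close>.
\<close>

datatype instr = Assign nat poly_expr poly_expr | Branch nat nat nat

type_synonym program = "instr list"

definition bss_program :: "program \<Rightarrow> bool" where
  "bss_program P \<longleftrightarrow> (\<forall>i p q. Assign i p q \<in> set P \<longrightarrow> (\<exists>R. poly_val q R \<noteq> 0))"

datatype snapshot = Snapshot (regs: "nat \<Rightarrow> real") (pc: nat)

text \<open>
  \<open>None\<close>: the rational function has no value at the current register contents.
\<close>

fun exec :: "instr \<Rightarrow> snapshot \<Rightarrow> snapshot option" where
  "exec (Assign i p q) (Snapshot R a) =
     (if poly_val q R = 0 then None
      else Some (Snapshot (R(i := poly_val p R / poly_val q R)) (Suc a)))"
| "exec (Branch i k l) (Snapshot R a) = Some (Snapshot R (if R i > 0 then k else l))"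

definition halted :: "program \<Rightarrow> snapshot \<Rightarrow> bool" where
  "halted P S \<longleftrightarrow> length P \<le> pc S"

definition initial :: "real \<Rightarrow> snapshot" where
  "initial x = Snapshot ((\<lambda>_. 0)(0 := x)) 0"

text \<open>
  Ordinals are represented by well-orders \<open>r\<close>, the times being the elements of \<open>Field r\<close>.
  At a limit time \<open>t\<close>, a property holds eventually in \<open>before r t\<close> iff there is \<open>s < t\<close> such
  that it holds at all \<open>u\<close> with \<open>s < u < t\<close>, and it holds frequently iff for every \<open>s < t\<close>
  there is \<open>u\<close> with \<open>s < u < t\<close> where it holds (\<open>wo_time.eventually_before\<close> and
  \<open>wo_time.frequently_before\<close>).
\<close>

definition pred_time :: "'t rel \<Rightarrow> 't \<Rightarrow> 't \<Rightarrow> bool" where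
  "pred_time r s t \<longleftrightarrow> s \<in> underS r t \<and> aboveS r s \<inter> underS r t = {}"

definition limit_time :: "'t rel \<Rightarrow> 't \<Rightarrow> bool" where
  "limit_time r t \<longleftrightarrow> underS r t \<noteq> {} \<and> \<not> (\<exists>s. pred_time r s t)"

definition before :: "'t rel \<Rightarrow> 't \<Rightarrow> 't filter" where
  "before r t = (INF s\<in>underS r t. principal (aboveS r s \<inter> underS r t))"

definition sLimP :: "'t filter \<Rightarrow> ('t \<Rightarrow> real) \<Rightarrow> ereal set" where
  "sLimP F f =
     {ereal l | l. \<forall>\<epsilon>>0. \<exists>\<^sub>F s in F. \<bar>f s - l\<bar> < \<epsilon>} \<union>
     {a. a = \<infinity> \<and> (\<forall>x. \<forall>\<^sub>F s in F. f s > x)} \<union>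
     {a. a = -\<infinity> \<and> (\<forall>x. \<forall>\<^sub>F s in F. f s < x)}"

text \<open>\<open>L F f l\<close>: the rule \<open>L\<close> assigns the value \<open>l\<close> to the sequence \<open>f\<close> along \<open>F\<close>.\<close>

type_synonym 't limit_rule = "'t filter \<Rightarrow> ('t \<Rightarrow> real) \<Rightarrow> real \<Rightarrow> bool"

definition itbm_rule :: "'t limit_rule" where
  "itbm_rule F f l \<longleftrightarrow> (f \<longlongrightarrow> l) F"

definition witbm_rule :: "'t limit_rule" where
  "witbm_rule F f l \<longleftrightarrow>
     (f \<longlongrightarrow> l) F \<or>
     l = 0 \<and> (\<exists>m \<in> sLimP F f. (\<forall>a \<in> sLimP F f. m \<le> a) \<and> \<bar>m\<bar> = \<infinity>)"

definition computation ::
  "'t limit_rule \<Rightarrow> program \<Rightarrow> real \<Rightarrow> 't rel \<Rightarrow> ('t \<Rightarrow> snapshot) \<Rightarrow> bool" where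
  "computation L P x r C \<longleftrightarrow> Well_order r \<and>
     (\<forall>t \<in> Field r.
        (underS r t = {} \<longrightarrow> C t = initial x) \<and>
        (\<forall>s. pred_time r s t \<longrightarrow>
           \<not> halted P (C s) \<and> exec (P ! pc (C s)) (C s) = Some (C t)) \<and>
        (limit_time r t \<longrightarrow>
           enat (pc (C t)) = Liminf (before r t) (\<lambda>s. enat (pc (C s))) \<and>
           (\<forall>i. L (before r t) (\<lambda>s. regs (C s) i) (regs (C t) i))))"

text \<open>The computation along \<open>r\<close> halts at the last time of \<open>r\<close>, with output \<open>y\<close>.\<close>

definition halting_computation ::
  "'t limit_rule \<Rightarrow> program \<Rightarrow> real \<Rightarrow> real \<Rightarrow> 't rel \<Rightarrow> ('t \<Rightarrow> snapshot) \<Rightarrow> bool" where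
  "halting_computation L P x y r C \<longleftrightarrow> computation L P x r C \<and>
     (\<exists>T \<in> Field r. (\<forall>t \<in> Field r. (t, T) \<in> r) \<and> halted P (C T) \<and> regs (C T) 0 = y)"

text \<open>
  In the following definition, time ranges over well-orders on sets of natural numbers, i.e. over
  the countable ordinals.  Allowing well-orders on sets of elements of any other type does not
  give more halting computations: see \<open>halts_with_any_time\<close> at the end of this theory.
\<close>

definition halts_with :: "nat limit_rule \<Rightarrow> program \<Rightarrow> real \<Rightarrow> real \<Rightarrow> bool" where
  "halts_with L P x y \<longleftrightarrow> (\<exists>(r :: nat rel) C. halting_computation L P x y r C)"

definition ITBM_computable :: "(real \<Rightarrow> real) \<Rightarrow> bool" where
  "ITBM_computable f \<longleftrightarrow> (\<exists>P. bss_program P \<and> (\<forall>x. halts_with itbm_rule P x (f x)))"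

definition WITBM_computable :: "(real \<Rightarrow> real) \<Rightarrow> bool" where
  "WITBM_computable f \<longleftrightarrow> (\<exists>P. bss_program P \<and> (\<forall>x. halts_with witbm_rule P x (f x)))"

locale wo_time =
  fixes r :: "'t rel"
  assumes wo: "Well_order r"
begin

definition lt :: "'t \<Rightarrow> 't \<Rightarrow> bool" where "lt s t \<longleftrightarrow> s \<noteq> t \<and> (s, t) \<in> r"

lemma lt_Field: "lt s t \<Longrightarrow> s \<in> Field r \<and> t \<in> Field r"
  by (auto simp: lt_def Field_def)

lemma lt_trans: "lt s t \<Longrightarrow> lt t u \<Longrightarrow> lt s u"
  using wo unfolding lt_def order_on_defs trans_def antisym_def by metis

lemma lt_irrefl: "\<not> lt s s"
  by (simp add: lt_def)

lemma lt_linear: "s \<in> Field r \<Longrightarrow> t \<in> Field r \<Longrightarrow> lt s t \<or> s = t \<or> lt t s"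
  using wo unfolding lt_def order_on_defs total_on_def by metis

lemma lt_induct:
  assumes "\<And>t. (\<And>s. lt s t \<Longrightarrow> Q s) \<Longrightarrow> Q t"
  shows "Q t"
proof -
  have "wf (r - Id)"
    using wo by (simp add: well_order_on_def)
  then show ?thesis
    by (induction t rule: wf_induct_rule) (auto intro: assms simp: lt_def)
qed

lemma underS_lt: "underS r t = {s. lt s t}"
  by (auto simp: underS_def lt_def)

lemma aboveS_lt: "aboveS r t = {s. lt t s}"
  by (auto simp: aboveS_def lt_def)

lemma pred_time_lt: "pred_time r s t \<longleftrightarrow> lt s t \<and> \<not> (\<exists>u. lt s u \<and> lt u t)"
  by (auto simp: pred_time_def underS_lt aboveS_lt)

lemma limit_time_lt:
  "limit_time r t \<longleftrightarrow> (\<exists>s. lt s t) \<and> (\<forall>s. lt s t \<longrightarrow> (\<exists>u. lt s u \<and> lt u t))"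
  by (auto simp: limit_time_def pred_time_lt underS_lt)

lemma eventually_before:
  assumes "limit_time r t"
  shows "eventually Q (before r t) \<longleftrightarrow> (\<exists>s. lt s t \<and> (\<forall>u. lt s u \<longrightarrow> lt u t \<longrightarrow> Q u))"
proof -
  have "eventually Q (before r t) \<longleftrightarrow>
      (\<exists>s\<in>underS r t. eventually Q (principal (aboveS r s \<inter> underS r t)))"
    unfolding before_def
  proof (rule eventually_INF_base)
    show "underS r t \<noteq> {}"
      using assms by (simp add: limit_time_def)
    fix a b assume ab: "a \<in> underS r t" "b \<in> underS r t"
    then have "lt a b \<or> a = b \<or> lt b a"
      using lt_Field lt_linear by (auto simp: underS_lt)
    then show "\<exists>x\<in>underS r t. principal (aboveS r x \<inter> underS r t) \<le>
        inf (principal (aboveS r a \<inter> underS r t)) (principal (aboveS r b \<inter> underS r t))"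
      using ab lt_trans by (auto simp: underS_lt aboveS_lt)
  qed
  then show ?thesis
    by (auto simp: eventually_principal underS_lt aboveS_lt)
qed

lemma frequently_before:
  assumes "limit_time r t"
  shows "frequently Q (before r t) \<longleftrightarrow> (\<forall>s. lt s t \<longrightarrow> (\<exists>u. lt s u \<and> lt u t \<and> Q u))"
  using eventually_before[OF assms, of "\<lambda>u. \<not> Q u"] unfolding frequently_def by blast

lemma before_ne_bot:
  assumes "limit_time r t"
  shows "before r t \<noteq> bot"
  using eventually_before[OF assms, of "\<lambda>_. False"] assms
  by (auto simp: limit_time_lt trivial_limit_def)

lemma Liminf_attained:
  assumes "limit_time r t" "enat k = Liminf (before r t) (\<lambda>s. enat (g s))"
  shows "\<exists>\<^sub>F s in before r t. g s = k"
proof (rule ccontr)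
  assume "\<not> ?thesis"
  then have ne: "\<forall>\<^sub>F s in before r t. g s \<noteq> k"
    by (simp add: frequently_def)
  have ge: "\<forall>\<^sub>F s in before r t. k \<le> g s"
  proof (cases k)
    case (Suc j)
    then have "enat j < Liminf (before r t) (\<lambda>s. enat (g s))"
      using assms(2) by (metis enat_ord_simps(2) lessI)
    from less_LiminfD[OF this] show ?thesis
      by eventually_elim (simp add: Suc)
  qed simp
  have "\<forall>\<^sub>F s in before r t. enat (Suc k) \<le> enat (g s)"
    using ne ge by eventually_elim auto
  then have "enat (Suc k) \<le> Liminf (before r t) (\<lambda>s. enat (g s))"
    by (rule Liminf_bounded)
  then show False
    by (simp flip: assms(2))
qed

end

lemma witbm_rule_cases:
  assumes "witbm_rule F f l"
  shows "(f \<longlongrightarrow> l) F \<or> (\<forall>x. \<forall>\<^sub>F s in F. f s > x) \<or> (\<forall>x. \<forall>\<^sub>F s in F. f s < x)"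
  using assms by (auto simp: witbm_rule_def sLimP_def)

lemma rule_cases:
  assumes "L \<in> {itbm_rule, witbm_rule}" "L F f l"
  shows "(f \<longlongrightarrow> l) F \<or> (\<forall>x. \<forall>\<^sub>F s in F. f s > x) \<or> (\<forall>x. \<forall>\<^sub>F s in F. f s < x)"
  using assms witbm_rule_cases[of F f l] by (auto simp: itbm_rule_def)

lemma rule_const:
  assumes "L \<in> {itbm_rule, witbm_rule}" "L F f l" "F \<noteq> bot" "\<forall>\<^sub>F s in F. f s = c"
  shows "l = c"
proof -
  have no: False if "\<forall>\<^sub>F s in F. f s \<noteq> c"
    using eventually_conj[OF that assms(4)] assms(3) by (auto simp: eventually_False)
  consider "(f \<longlongrightarrow> l) F" | "\<forall>x. \<forall>\<^sub>F s in F. f s > x" | "\<forall>x. \<forall>\<^sub>F s in F. f s < x"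
    using rule_cases[of L F f l] assms(1,2) by blast
  then show ?thesis
  proof cases
    assume "(f \<longlongrightarrow> l) F"
    moreover have "(f \<longlongrightarrow> c) F"
      using tendsto_eventually[OF assms(4)] .
    ultimately show ?thesis
      using tendsto_unique[OF assms(3)] by blast
  next
    assume "\<forall>x. \<forall>\<^sub>F s in F. f s > x"
    then have "\<forall>\<^sub>F s in F. f s > c" by blast
    then have "\<forall>\<^sub>F s in F. f s \<noteq> c" by eventually_elim simp
    then show ?thesis using no by blast
  next
    assume "\<forall>x. \<forall>\<^sub>F s in F. f s < x"
    then have "\<forall>\<^sub>F s in F. f s < c" by blast
    then have "\<forall>\<^sub>F s in F. f s \<noteq> c" by eventually_elim simp
    then show ?thesis using no by blast
  qed
qed

theorem halting_computation_countable:
  fixes r :: "'t rel"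
  assumes L: "L \<in> {itbm_rule, witbm_rule}" and H: "halting_computation L P x y r C"
  shows "countable (Field r)"
proof (rule ccontr)
  assume unc: "uncountable (Field r)"
  interpret wo_time r
    using H by unfold_locales (simp add: halting_computation_def computation_def)
  have succ: "\<not> halted P (C s)" "exec (P ! pc (C s)) (C s) = Some (C t)"
    if "pred_time r s t" for s t
    using H that lt_Field[of s t] pred_time_lt[of s t]
    by (auto simp: halting_computation_def computation_def)
  have lim_pc: "enat (pc (C t)) = Liminf (before r t) (\<lambda>s. enat (pc (C s)))"
    and lim_reg: "L (before r t) (\<lambda>s. regs (C s) i) (regs (C t) i)"
    if "limit_time r t" for t i
    using H that lt_Field[of _ t] limit_time_lt[of t]
    by (auto simp: halting_computation_def computation_def)
  obtain T where T: "T \<in> Field r" "\<And>t. t \<in> Field r \<Longrightarrow> t = T \<or> lt t T" "halted P (C T)"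
    using H by (auto simp: halting_computation_def lt_def)
  have ex_least: "\<exists>t. Q t \<and> (\<forall>s. lt s t \<longrightarrow> \<not> Q s)" if "Q t" for Q t
    using that by (induction t rule: lt_induct) blast
  have ex_succ: "\<exists>u. pred_time r s u \<and> (u = t \<or> lt u t)" if "lt s t" for s t
  proof -
    from ex_least[of "lt s", OF that] obtain u where u: "lt s u" "\<And>v. lt v u \<Longrightarrow> \<not> lt s v"
      by blast
    then have "pred_time r s u"
      by (auto simp: pred_time_lt)
    moreover have "u = t \<or> lt u t"
      using lt_linear[of u t] u that lt_Field by blast
    ultimately show ?thesis by blast
  qed
  have not_halted: "\<not> halted P (C s)" if "lt s t" for s t
    using ex_succ[OF that] succ by blast

  have "uncountable {s. lt s T}"
  proof
    assume "countable {s. lt s T}"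
    then have "countable (insert T {s. lt s T})" by simp
    moreover have "Field r \<subseteq> insert T {s. lt s T}" using T(2) by blast
    ultimately show False using unc countable_subset by blast
  qed
  then have "\<exists>t. uncountable {s. lt s t} \<and> (\<forall>t'. lt t' t \<longrightarrow> \<not> uncountable {s. lt s t'})"
    by (rule ex_least)
  then obtain t0
    where t0: "uncountable {s. lt s t0}" "\<And>t. lt t t0 \<Longrightarrow> countable {s. lt s t}"
    by (elim exE conjE) simp
  have bounded: "\<exists>u. lt u t0 \<and> (\<forall>b\<in>B. lt b u)" if B: "countable B" "\<And>b. b \<in> B \<Longrightarrow> lt b t0" for B
  proof (rule ccontr)
    assume no: "\<not> ?thesis"
    have "{s. lt s t0} \<subseteq> B \<union> (\<Union>b\<in>B. {s. lt s b})"
    proof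
      fix s assume s: "s \<in> {s. lt s t0}"
      then obtain b where "b \<in> B" "\<not> lt b s" using no by blast
      then show "s \<in> B \<union> (\<Union>b\<in>B. {s. lt s b})"
        using s lt_linear[of s b] B(2)[of b] lt_Field by blast
    qed
    moreover have "countable (B \<union> (\<Union>b\<in>B. {s. lt s b}))"
      using B t0(2) by auto
    ultimately show False
      using t0(1) countable_subset by blast
  qed
  have lim0: "limit_time r t0"
    unfolding limit_time_lt
  proof (intro conjI allI impI)
    show "\<exists>s. lt s t0" using bounded[of "{}"] by auto
    fix s assume "lt s t0" then show "\<exists>u. lt s u \<and> lt u t0" using bounded[of "{s}"] by auto
  qed
  have count_ev: "\<exists>u. lt u t0 \<and> (\<forall>n. \<forall>s. lt u s \<longrightarrow> lt s t0 \<longrightarrow> Q n s)"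
    if Q: "\<And>n::nat. \<forall>\<^sub>F s in before r t0. Q n s" for Q
  proof -
    have "\<forall>n. \<exists>b. lt b t0 \<and> (\<forall>s. lt b s \<longrightarrow> lt s t0 \<longrightarrow> Q n s)"
      using Q by (simp add: eventually_before[OF lim0])
    then obtain b where b: "\<And>n. lt (b n) t0" "\<And>n s. lt (b n) s \<Longrightarrow> lt s t0 \<Longrightarrow> Q n s"
      by metis
    obtain u where "lt u t0" "\<And>n. lt (b n) u"
      using bounded[of "range b"] b(1) by auto
    then show ?thesis using b(2) lt_trans by metis
  qed
  have no_ev: False if "\<And>n::nat. \<forall>\<^sub>F s in before r t0. Q n s" "\<And>s. \<exists>n. \<not> Q n s" for Q
  proof -
    have "\<exists>u. lt u t0 \<and> (\<forall>n. \<forall>s. lt u s \<longrightarrow> lt s t0 \<longrightarrow> Q n s)"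
      by (rule count_ev) (rule that(1))
    then obtain u where "lt u t0" "\<And>n s. lt u s \<Longrightarrow> lt s t0 \<Longrightarrow> Q n s"
      by metis
    then show False using that(2) lim0 limit_time_lt by metis
  qed
  define \<rho> where "\<rho> = regs (C t0)"
  have reg_ev: "\<forall>\<^sub>F s in before r t0. regs (C s) i = \<rho> i" for i
  proof -
    define g where "g = (\<lambda>s. regs (C s) i)"
    have "L (before r t0) g (\<rho> i)"
      using lim_reg[OF lim0] by (simp add: g_def \<rho>_def)
    then consider "(g \<longlongrightarrow> \<rho> i) (before r t0)" | "\<forall>x. \<forall>\<^sub>F s in before r t0. g s > x"
      | "\<forall>x. \<forall>\<^sub>F s in before r t0. g s < x"
      using rule_cases[of L "before r t0" g "\<rho> i"] L by blast
    then have "(g \<longlongrightarrow> \<rho> i) (before r t0)"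
    proof cases
      case 1 then show ?thesis .
    next
      assume a: "\<forall>x. \<forall>\<^sub>F s in before r t0. g s > x"
      have False
        by (rule no_ev[of "\<lambda>n s. g s > real n"]) (use a in blast, meson real_arch_simple not_less)
      then show ?thesis ..
    next
      assume a: "\<forall>x. \<forall>\<^sub>F s in before r t0. g s < x"
      have "\<exists>n. - g s \<le> real n" for s by (rule real_arch_simple)
      then have b: "\<exists>n. \<not> g s < - real n" for s by (smt (verit))
      have False
        by (rule no_ev[of "\<lambda>n s. g s < - real n"]) (use a b in blast)+
      then show ?thesis ..
    qed
    then have "\<And>n. \<forall>\<^sub>F s in before r t0. dist (g s) (\<rho> i) < inverse (real (Suc n))"
      by (simp add: tendsto_iff)
    then have "\<exists>u. lt u t0 \<and> (\<forall>n. \<forall>s. lt u s \<longrightarrow> lt s t0 \<longrightarrow>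
        dist (g s) (\<rho> i) < inverse (real (Suc n)))"
      by (rule count_ev)
    then obtain u where u: "lt u t0"
      "\<And>n s. lt u s \<Longrightarrow> lt s t0 \<Longrightarrow> dist (g s) (\<rho> i) < inverse (real (Suc n))"
      by metis
    have "g s = \<rho> i" if "lt u s" "lt s t0" for s
    proof (rule ccontr)
      assume "g s \<noteq> \<rho> i"
      then obtain n where "inverse (real (Suc n)) < dist (g s) (\<rho> i)"
        using reals_Archimedean[of "dist (g s) (\<rho> i)"] by auto
      then show False using u(2)[OF that, of n] by linarith
    qed
    then show ?thesis
      using u(1) by (auto simp: eventually_before[OF lim0] g_def)
  qed
  have "\<exists>u. lt u t0 \<and> (\<forall>i. \<forall>s. lt u s \<longrightarrow> lt s t0 \<longrightarrow> regs (C s) i = \<rho> i)"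
    by (rule count_ev) (rule reg_ev)
  then obtain u where u: "lt u t0" "\<And>s. lt u s \<Longrightarrow> lt s t0 \<Longrightarrow> regs (C s) = \<rho>"
    by (auto simp: fun_eq_iff)

  text \<open>From \<open>t0\<close> on, every snapshot has already occurred strictly between \<open>u\<close> and \<open>t0\<close>.\<close>
  have shadow: "t = t0 \<or> lt t0 t \<Longrightarrow> \<exists>s. lt u s \<and> lt s t0 \<and> C s = C t" for t
  proof (induction t rule: lt_induct)
    case (1 t)
    have from_pc: "\<exists>s. lt u s \<and> lt s t0 \<and> C s = C t" if "regs (C t) = \<rho>"
      "lt u w" "lt w t0" "pc (C w) = pc (C t)" for w
      using that u(2)[of w] by (metis snapshot.expand)
    show ?case
    proof (cases "t = t0")
      case True
      have "\<exists>w. lt u w \<and> lt w t0 \<and> pc (C w) = pc (C t0)"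
        using Liminf_attained[OF lim0 lim_pc[OF lim0]] u(1)
        by (auto simp: frequently_before[OF lim0])
      then show ?thesis using from_pc True \<rho>_def by blast
    next
      case False
      then have t: "lt t0 t" using 1 by blast
      show ?thesis
      proof (cases "limit_time r t")
        case False
        then obtain s where s: "pred_time r s t"
          using t by (auto simp: limit_time_def underS_lt)
        then have "s = t0 \<or> lt t0 s"
          using t lt_linear[of s t0] lt_Field by (metis pred_time_lt)
        then obtain s' where s': "lt u s'" "lt s' t0" "C s' = C s"
          using 1 s by (auto simp: pred_time_lt)
        obtain v where v: "pred_time r s' v" "v = t0 \<or> lt v t0"
          using ex_succ[OF s'(2)] by blast
        have "v \<noteq> t0"
          using v(1) s'(2) lim0 by (auto simp: limit_time_def)
        moreover have "C v = C t"
          using succ(2)[OF v(1)] succ(2)[OF s] s'(3) by simp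
        moreover have "lt u v"
          using v(1) s'(1) lt_trans by (auto simp: pred_time_lt)
        ultimately show ?thesis using v(2) by blast
      next
        case True
        have IH: "\<exists>s'. lt u s' \<and> lt s' t0 \<and> C s' = C s" if "lt t0 s" "lt s t" for s
          using 1 that by blast
        have "\<forall>\<^sub>F s in before r t. regs (C s) i = \<rho> i" for i
          unfolding eventually_before[OF True] using t IH u(2) by metis
        then have "regs (C t) i = \<rho> i" for i
          using rule_const[OF L lim_reg[OF True] before_ne_bot[OF True]] by blast
        then have regs: "regs (C t) = \<rho>" by auto
        obtain s where "lt t0 s" "lt s t" "pc (C s) = pc (C t)"
          using Liminf_attained[OF True lim_pc[OF True]] t
          by (auto simp: frequently_before[OF True])
        then show ?thesis using IH from_pc[OF regs] by metis
      qed
    qed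
  qed
  have "T = t0 \<or> lt t0 T"
    using T(2)[of t0] u(1) lt_Field by blast
  then show False
    using shadow not_halted T(3) by metis
qed

lemma Liminf_filtermap_linorder:
  fixes g :: "'b \<Rightarrow> 'c :: complete_linorder"
  shows "Liminf (filtermap h F) g = Liminf F (\<lambda>x. g (h x))"
proof -
  have "c \<le> Liminf (filtermap h F) g \<longleftrightarrow> c \<le> Liminf F (\<lambda>x. g (h x))" for c
    by (simp add: le_Liminf_iff eventually_filtermap)
  then show ?thesis by (meson order_antisym order_refl)
qed

lemma sLimP_filtermap: "sLimP (filtermap h F) g = sLimP F (\<lambda>x. g (h x))"
  by (simp add: sLimP_def frequently_def eventually_filtermap)

lemma halting_computation_transfer:
  fixes r :: "'t rel" and h :: "'t \<Rightarrow> 'u"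
  assumes inj: "inj_on h (Field r)"
    and L: "\<And>F g l. L' (filtermap h F) g l \<longleftrightarrow> L F (\<lambda>x. g (h x)) l"
    and Lcong: "\<And>F g g' l. \<forall>\<^sub>F s in F. g s = g' s \<Longrightarrow> L F g l \<Longrightarrow> L F g' l"
    and H: "halting_computation L P x y r C"
  shows "halting_computation L' P x y (dir_image r h) (\<lambda>t. C (inv_into (Field r) h t))"
proof -
  define r' where "r' = dir_image r h"
  define C' where "C' = (\<lambda>t. C (inv_into (Field r) h t))"
  have wo: "Well_order r"
    using H by (simp add: halting_computation_def computation_def)
  then have wo': "Well_order r'"
    unfolding r'_def using inj by (intro Well_order_dir_image)
  interpret A: wo_time r by unfold_locales (rule wo)
  interpret B: wo_time r' by unfold_locales (rule wo')
  have field: "Field r' = h ` Field r"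
    unfolding r'_def by (rule dir_image_Field)
  have r'_iff: "(h a, h b) \<in> r' \<longleftrightarrow> (a, b) \<in> r" if "a \<in> Field r" "b \<in> Field r" for a b
  proof -
    have "(a', b') \<in> r \<Longrightarrow> h a = h a' \<Longrightarrow> h b = h b' \<Longrightarrow> (a, b) \<in> r" for a' b'
      using inj_onD[OF inj, of a a'] inj_onD[OF inj, of b b'] that by (auto simp: Field_def)
    then show ?thesis
      by (auto simp: r'_def dir_image_def)
  qed
  have lt: "B.lt (h a) (h b) \<longleftrightarrow> A.lt a b" if "a \<in> Field r" "b \<in> Field r" for a b
    using r'_iff[OF that] inj that by (auto simp: A.lt_def B.lt_def inj_on_def)
  have C': "C' (h t) = C t" if "t \<in> Field r" for t
    using inj that by (simp add: C'_def)
  have ltE: "B.lt a b \<Longrightarrow> \<exists>a' b'. a = h a' \<and> b = h b' \<and> a' \<in> Field r \<and> b' \<in> Field r" for a b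
    using B.lt_Field[of a b] field by auto
  have pt: "pred_time r' (h s) (h t) \<longleftrightarrow> pred_time r s t" if "s \<in> Field r" "t \<in> Field r" for s t
    unfolding A.pred_time_lt B.pred_time_lt using that lt ltE A.lt_Field by metis
  have zero: "underS r' (h t) = {} \<longleftrightarrow> underS r t = {}" if "t \<in> Field r" for t
    unfolding A.underS_lt B.underS_lt using that lt ltE A.lt_Field by blast
  have ptE: "pred_time r' s (h t) \<Longrightarrow> \<exists>s'. s' \<in> Field r \<and> s = h s'" for s t
    unfolding B.pred_time_lt using ltE by blast
  have lim: "limit_time r' (h t) \<longleftrightarrow> limit_time r t" if "t \<in> Field r" for t
  proof -
    have "s \<in> Field r" if "pred_time r s t" for s
      using that A.lt_Field by (auto simp: A.pred_time_lt)
    then have "(\<exists>s. pred_time r' s (h t)) \<longleftrightarrow> (\<exists>s. pred_time r s t)"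
      using pt[OF _ that] ptE[of _ t] by blast
    then show ?thesis
      by (simp add: limit_time_def zero[OF that])
  qed
  have bef: "before r' (h t) = filtermap h (before r t)" if t: "t \<in> Field r" "limit_time r t" for t
  proof (rule filter_eqI)
    fix Q
    have "limit_time r' (h t)" using lim[OF t(1)] t(2) by simp
    note ev = B.eventually_before[OF this] A.eventually_before[OF t(2)]
    have "(\<exists>s. B.lt s (h t) \<and> (\<forall>u. B.lt s u \<longrightarrow> B.lt u (h t) \<longrightarrow> Q u)) \<longleftrightarrow>
        (\<exists>s\<in>Field r. B.lt (h s) (h t) \<and>
          (\<forall>u\<in>Field r. B.lt (h s) (h u) \<longrightarrow> B.lt (h u) (h t) \<longrightarrow> Q (h u)))"
      using ltE by fast
    also have "\<dots> \<longleftrightarrow> (\<exists>s\<in>Field r. A.lt s t \<and> (\<forall>u\<in>Field r. A.lt s u \<longrightarrow> A.lt u t \<longrightarrow> Q (h u)))"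
      by (intro bex_cong refl) (simp add: lt t(1))
    also have "\<dots> \<longleftrightarrow> (\<exists>s. A.lt s t \<and> (\<forall>u. A.lt s u \<longrightarrow> A.lt u t \<longrightarrow> Q (h u)))"
      using A.lt_Field by fast
    finally show "eventually Q (before r' (h t)) \<longleftrightarrow> eventually Q (filtermap h (before r t))"
      by (simp add: ev eventually_filtermap)
  qed
  have same: "\<forall>\<^sub>F s in before r t. C s = C' (h s)" if "limit_time r t" for t
    using that C' A.lt_Field unfolding A.eventually_before[OF that] A.limit_time_lt by metis
  have "computation L' P x r' C'"
    unfolding computation_def
  proof (intro conjI ballI wo')
    fix t' assume "t' \<in> Field r'"
    then obtain t where t: "t \<in> Field r" "t' = h t" using field by auto
    have orig: "underS r t = {} \<longrightarrow> C t = initial x"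
      "\<And>s. pred_time r s t \<Longrightarrow> \<not> halted P (C s) \<and> exec (P ! pc (C s)) (C s) = Some (C t)"
      "limit_time r t \<Longrightarrow> enat (pc (C t)) = Liminf (before r t) (\<lambda>s. enat (pc (C s)))"
      "\<And>i. limit_time r t \<Longrightarrow> L (before r t) (\<lambda>s. regs (C s) i) (regs (C t) i)"
      using H t(1) by (auto simp: halting_computation_def computation_def)
    show "underS r' t' = {} \<longrightarrow> C' t' = initial x"
      using zero t C' orig(1) by simp
    show "\<forall>s. pred_time r' s t' \<longrightarrow>
        \<not> halted P (C' s) \<and> exec (P ! pc (C' s)) (C' s) = Some (C' t')"
      using pt ptE t C' orig(2) by metis
    show "limit_time r' t' \<longrightarrow>
        enat (pc (C' t')) = Liminf (before r' t') (\<lambda>s. enat (pc (C' s))) \<and>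
        (\<forall>i. L' (before r' t') (\<lambda>s. regs (C' s) i) (regs (C' t') i))"
    proof (intro impI conjI allI)
      assume "limit_time r' t'"
      then have l: "limit_time r t" using lim[OF t(1)] t(2) by simp
      note b = bef[OF t(1) l]
      have "Liminf (before r t) (\<lambda>s. enat (pc (C s))) =
          Liminf (before r t) (\<lambda>s. enat (pc (C' (h s))))"
        by (rule Liminf_eq) (use same[OF l] in eventually_elim, simp)
      then show "enat (pc (C' t')) = Liminf (before r' t') (\<lambda>s. enat (pc (C' s)))"
        using orig(3)[OF l] t C' by (simp add: b Liminf_filtermap_linorder)
      fix i
      have "L (before r t) (\<lambda>s. regs (C' (h s)) i) (regs (C t) i)"
        by (rule Lcong[OF _ orig(4)[OF l]]) (use same[OF l] in eventually_elim, simp)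
      then show "L' (before r' t') (\<lambda>s. regs (C' s) i) (regs (C' t') i)"
        using t C' by (simp add: b L)
    qed
  qed
  moreover have "\<exists>T \<in> Field r'. (\<forall>t \<in> Field r'. (t, T) \<in> r') \<and> halted P (C' T) \<and> regs (C' T) 0 = y"
  proof -
    obtain T where T: "T \<in> Field r" "\<forall>t \<in> Field r. (t, T) \<in> r" "halted P (C T)" "regs (C T) 0 = y"
      using H by (auto simp: halting_computation_def)
    then show ?thesis
      using field r'_iff C' by (intro bexI[of _ "h T"]) auto
  qed
  ultimately show ?thesis
    by (simp add: halting_computation_def r'_def C'_def)
qed

lemma itbm_rule_cong: "\<forall>\<^sub>F s in F. g s = g' s \<Longrightarrow> itbm_rule F g l \<Longrightarrow> itbm_rule F g' l"
  unfolding itbm_rule_def by (rule Lim_transform_eventually)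

lemma sLimP_cong:
  assumes "\<forall>\<^sub>F s in F. g s = g' s"
  shows "sLimP F g = sLimP F g'"
proof -
  have ev: "eventually (\<lambda>s. Q (g s)) F \<longleftrightarrow> eventually (\<lambda>s. Q (g' s)) F" for Q
    by (rule eventually_cong[OF assms]) simp
  show ?thesis
    unfolding sLimP_def frequently_def ev[of "\<lambda>z. \<not> \<bar>z - l\<bar> < \<epsilon>" for l \<epsilon>]
      ev[of "\<lambda>z. z > x" for x] ev[of "\<lambda>z. z < x" for x] ..
qed

lemma witbm_rule_cong: "\<forall>\<^sub>F s in F. g s = g' s \<Longrightarrow> witbm_rule F g l \<Longrightarrow> witbm_rule F g' l"
  unfolding witbm_rule_def using sLimP_cong[of g g' F] Lim_transform_eventually[of g l F g'] by auto

theorem halts_with_any_time: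
  fixes r :: "'t rel"
  shows "halting_computation itbm_rule P x y r C \<Longrightarrow> halts_with itbm_rule P x y"
    and "halting_computation witbm_rule P x y r C \<Longrightarrow> halts_with witbm_rule P x y"
proof -
  assume H: "halting_computation itbm_rule P x y r C"
  then have "countable (Field r)"
    using halting_computation_countable by blast
  then obtain h :: "'t \<Rightarrow> nat" where h: "inj_on h (Field r)"
    by (auto simp: countable_def)
  show "halts_with itbm_rule P x y"
    unfolding halts_with_def
  proof (intro exI)
    show "halting_computation itbm_rule P x y (dir_image r h) (\<lambda>t. C (inv_into (Field r) h t))"
      by (rule halting_computation_transfer[OF h _ _ H])
        (simp add: itbm_rule_def filterlim_filtermap, rule itbm_rule_cong)
  qed
next
  assume H: "halting_computation witbm_rule P x y r C"
  then have "countable (Field r)"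
    using halting_computation_countable by blast
  then obtain h :: "'t \<Rightarrow> nat" where h: "inj_on h (Field r)"
    by (auto simp: countable_def)
  show "halts_with witbm_rule P x y"
    unfolding halts_with_def
  proof (intro exI)
    show "halting_computation witbm_rule P x y (dir_image r h) (\<lambda>t. C (inv_into (Field r) h t))"
      by (rule halting_computation_transfer[OF h _ _ H])
        (simp add: witbm_rule_def filterlim_filtermap sLimP_filtermap, rule witbm_rule_cong)
  qed
qed

end

theory Submission
  imports Defs "HOL-Real_Asymp.Real_Asymp"
begin

text \<open>
  An \<open>ITBM\<close>-computation that does not crash is a \<open>WITBM\<close>-computation.  Conversely, each register
  value \<open>v\<close> is represented by the point \<open>(1 / (1 + v\<^sup>2), v / (1 + v\<^sup>2))\<close> of a circle, which
  compactifies the line by the point \<open>(0, 0)\<close>.  A sequence converging in \<open>\<real>\<close> or tending to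
  \<open>\<plusminus>\<infinity>\<close> is thereby turned into a convergent one, and the limit \<open>(0, 0)\<close> shows that the
  register has to be reset to 0.  Every instruction is simulated by a block of instructions that
  starts by replacing \<open>(0, 0)\<close> by the code \<open>(1, 0)\<close> of 0; within a block every register only takes
  its values for the simulated snapshot and for the next one, so no new divergence arises.
\<close>

section \<open>Refining a time order by finite traces\<close>

definition step :: "program \<Rightarrow> snapshot \<Rightarrow> snapshot \<Rightarrow> bool" where
  "step P S S' \<longleftrightarrow> \<not> halted P S \<and> exec (P ! pc S) S = Some S'"

text \<open>The end \<open>S'\<close> is kept out of the list, so chains concatenate without
  repeating a snapshot, and the trace of one time stops just before that of the next.\<close>

primrec chain :: "program \<Rightarrow> snapshot \<Rightarrow> snapshot list \<Rightarrow> snapshot \<Rightarrow> bool" where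
  "chain P S [] S' \<longleftrightarrow> S = S'"
| "chain P S (X # xs) S' \<longleftrightarrow> X = S \<and> (\<exists>S1. step P S S1 \<and> chain P S1 xs S')"

lemma chain_append:
  "chain P S xs S' \<Longrightarrow> chain P S' ys S'' \<Longrightarrow> chain P S (xs @ ys) S''"
  by (induction xs arbitrary: S) auto

lemma chain_hd: "chain P S xs S' \<Longrightarrow> xs \<noteq> [] \<Longrightarrow> hd xs = S"
  by (cases xs) auto

lemma chain_last: "chain P S xs S' \<Longrightarrow> xs \<noteq> [] \<Longrightarrow> step P (last xs) S'"
  by (induction xs arbitrary: S) auto

lemma chain_nth:
  "chain P S xs S' \<Longrightarrow> m < length xs \<Longrightarrow> step P ((xs @ [S']) ! m) ((xs @ [S']) ! Suc m)"
proof (induction xs arbitrary: S m)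
  case (Cons X xs)
  then obtain S1 where S1: "step P X S1" "chain P S1 xs S'" by auto
  show ?case
  proof (cases m)
    case 0
    then show ?thesis using chain_hd[OF S1(2)] S1 by (cases xs) auto
  qed (use Cons S1 in auto)
qed simp

text \<open>
  The times of the new computation are the pairs of a time \<open>s\<close> and a position in \<open>tr s\<close>, ordered
  lexicographically; its limit times are the pairs \<open>(t, 0)\<close> with \<open>t\<close> a limit time.
\<close>

lemma computation_of_traces:
  fixes r :: "'t rel" and tr :: "'t \<Rightarrow> snapshot list"
  assumes wo: "Well_order r"
    and nonempty: "\<And>s. s \<in> Field r \<Longrightarrow> tr s \<noteq> []"
    and start: "\<And>s. s \<in> Field r \<Longrightarrow> underS r s = {} \<Longrightarrow> hd (tr s) = initial x"
    and inner: "\<And>s m. s \<in> Field r \<Longrightarrow> Suc m < length (tr s) \<Longrightarrow> step P (tr s ! m) (tr s ! Suc m)"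
    and outer: "\<And>s t. pred_time r s t \<Longrightarrow> step P (last (tr s)) (hd (tr t))"
    and pc_le: "\<And>t. limit_time r t \<Longrightarrow> t \<in> Field r \<Longrightarrow>
      \<forall>\<^sub>F s in before r t. \<forall>S \<in> set (tr s). pc (hd (tr t)) \<le> pc S"
    and pc_ge: "\<And>t. limit_time r t \<Longrightarrow> t \<in> Field r \<Longrightarrow>
      \<exists>\<^sub>F s in before r t. \<exists>S \<in> set (tr s). pc S \<le> pc (hd (tr t))"
    and lim: "\<And>t i e. limit_time r t \<Longrightarrow> t \<in> Field r \<Longrightarrow> e > 0 \<Longrightarrow>
      \<forall>\<^sub>F s in before r t. \<forall>S \<in> set (tr s). dist (regs S i) (regs (hd (tr t)) i) < e"
    and T: "T \<in> Field r" "\<And>t. t \<in> Field r \<Longrightarrow> (t, T) \<in> r"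
      "halted P (last (tr T))" "regs (last (tr T)) 0 = y"
  shows "halts_with itbm_rule P x y"
proof -
  interpret A: wo_time r by unfold_locales (rule wo)
  define F where "F = {(s, m). s \<in> Field r \<and> m < length (tr s)}"
  define r' where "r' = {((s, m), (t, k)). (s, m) \<in> F \<and> (t, k) \<in> F \<and> (A.lt s t \<or> s = t \<and> m \<le> k)}"
  define C where "C = (\<lambda>(s, m). tr s ! m)"
  have refl: "refl_on F r'"
    by (auto simp: refl_on_def r'_def)
  then have field: "Field r' = F"
    by (auto simp: Field_def r'_def refl_on_def)
  have "wf (r' - Id)"
  proof (rule wfUNIVI)
    fix Q and p :: "'t \<times> nat"
    assume "\<forall>p. (\<forall>q. (q, p) \<in> r' - Id \<longrightarrow> Q q) \<longrightarrow> Q p"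
    then have step: "(\<And>q. (q, p) \<in> r' - Id \<Longrightarrow> Q q) \<Longrightarrow> Q p" for p
      by blast
    \<comment> \<open>Lexicographic induction: on the time outside, and within one trace on the
      position.\<close>
    have "\<forall>m. Q (s, m)" for s
    proof (induction s rule: A.lt_induct)
      case (1 s)
      have "Q (s, m)" for m
      proof (induction m rule: less_induct)
        case (less m)
        show ?case
        proof (rule step)
          fix q assume q: "(q, (s, m)) \<in> r' - Id"
          obtain s' m' where "q = (s', m')" by (cases q)
          then show "Q q" using q 1 less by (auto simp: r'_def)
        qed
      qed
      then show ?case by blast
    qed
    then show "Q p" by (cases p) auto
  qed
  moreover have "trans r'"
    by (auto simp: trans_def r'_def intro: A.lt_trans)
  moreover have "antisym r'"
    using A.lt_trans A.lt_irrefl by (auto simp: antisym_def r'_def)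
  moreover have "total_on F r'"
    using A.lt_linear by (fastforce simp: total_on_def r'_def F_def)
  moreover have "r' \<subseteq> F \<times> F"
    by (auto simp: r'_def)
  ultimately have wo': "Well_order r'"
    using refl by (simp add: order_on_defs field)
  interpret B: wo_time r' by unfold_locales (rule wo')
  have lt: "B.lt (s, m) (t, k) \<longleftrightarrow> (s, m) \<in> F \<and> (t, k) \<in> F \<and> (A.lt s t \<or> s = t \<and> m < k)" for s m t k
    unfolding B.lt_def using A.lt_irrefl by (auto simp: r'_def)
  have pos: "(s, 0) \<in> F" if "s \<in> Field r" for s
    using nonempty[OF that] that by (simp add: F_def)
  have min_iff: "underS r' (t, k) = {} \<longleftrightarrow> k = 0 \<and> underS r t = {}" if "(t, k) \<in> F" for t k
  proof (cases "k = 0")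
    case True
    then show ?thesis
      using that pos A.lt_Field by (fastforce simp: B.underS_lt A.underS_lt lt)
  next
    case False
    then have "B.lt (t, 0) (t, k)" using that pos by (simp add: lt F_def)
    then show ?thesis using False by (auto simp: B.underS_lt)
  qed
  have pred_inner: "pred_time r' p (t, Suc k) \<longleftrightarrow> p = (t, k)" if "(t, Suc k) \<in> F" for p t k
  proof -
    have k: "(t, k) \<in> F" using that by (simp add: F_def)
    have "B.lt (t, k) (t, Suc k)" using that k by (simp add: lt)
    moreover have "B.lt p (t, k) \<or> p = (t, k)" if "B.lt p (t, Suc k)" for p
      using that k by (cases p) (auto simp: lt)
    moreover have "\<not> B.lt p (t, Suc k)" if "B.lt (t, k) p" for p
      using that A.lt_irrefl A.lt_trans[of t "fst p" t] by (cases p) (auto simp: lt)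
    ultimately show ?thesis
      unfolding B.pred_time_lt by blast
  qed
  have pred_outer: "\<exists>s. pred_time r s t \<and> p = (s, length (tr s) - 1)"
    if "pred_time r' p (t, 0)" for p t
  proof -
    obtain s m where p: "p = (s, m)" by (cases p)
    have "B.lt (s, m) (t, 0)" and none: "\<And>q. B.lt (s, m) q \<Longrightarrow> \<not> B.lt q (t, 0)"
      using that unfolding B.pred_time_lt p by blast+
    then have sm: "(s, m) \<in> F" "(t, 0) \<in> F" "A.lt s t"
      by (auto simp: lt)
    have "pred_time r s t"
      unfolding A.pred_time_lt
      using sm none[of "(_, 0)"] pos A.lt_Field by (auto simp: lt)
    moreover have "\<not> Suc m < length (tr s)"
      using none[of "(s, Suc m)"] sm by (auto simp: lt F_def)
    then have "m = length (tr s) - 1"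
      using sm by (auto simp: F_def)
    ultimately show ?thesis using p by blast
  qed
  have lim_iff: "k = 0 \<and> limit_time r t" if "limit_time r' (t, k)" for t k
  proof -
    have tk: "(t, k) \<in> F" and no: "\<nexists>p. pred_time r' p (t, k)"
      using that by (auto simp: limit_time_def B.underS_lt lt)
    have k: "k = 0" using pred_inner tk no by (cases k) auto
    then obtain s where s: "A.lt s t"
      using \<open>limit_time r' (t, k)\<close> by (auto simp: limit_time_def B.underS_lt lt)
    \<comment> \<open>Nothing in \<open>tr s\<close> follows its last position, so a new time
      strictly between that position and \<open>(t, 0)\<close> belongs to the trace of some later
      \<open>u\<close>.\<close>
    have "\<exists>u. A.lt s u \<and> A.lt u t" if s: "A.lt s t" for s
    proof -
      have "s \<in> Field r" using s A.lt_Field by blast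
      then have "(s, length (tr s) - 1) \<in> F"
        using nonempty by (simp add: F_def)
      then have "B.lt (s, length (tr s) - 1) (t, k)" using s tk by (simp add: lt)
      then obtain u j where "B.lt (s, length (tr s) - 1) (u, j)" "B.lt (u, j) (t, k)"
        using \<open>limit_time r' (t, k)\<close> unfolding B.limit_time_lt by force
      then show ?thesis using k by (auto simp: lt F_def)
    qed
    then show ?thesis using k s by (auto simp: A.limit_time_lt)
  qed
  \<comment> \<open>Limits along pairs reduce to limits along the old times, with the property
    required of whole traces. In the converse direction the bound is the last position of
    \<open>tr s\<close>, past which only traces of times after \<open>s\<close> remain.\<close>
  have ev: "(\<forall>\<^sub>F p in before r' (t, 0). Q (C p)) \<longleftrightarrow> (\<forall>\<^sub>F s in before r t. \<forall>S \<in> set (tr s). Q S)"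
    if "limit_time r t" "limit_time r' (t, 0)" "t \<in> Field r" for t Q
  proof -
    have "(\<exists>p. B.lt p (t, 0) \<and> (\<forall>q. B.lt p q \<longrightarrow> B.lt q (t, 0) \<longrightarrow> Q (C q))) \<longleftrightarrow>
        (\<exists>s. A.lt s t \<and> (\<forall>u. A.lt s u \<longrightarrow> A.lt u t \<longrightarrow> (\<forall>S\<in>set (tr u). Q S)))"
      (is "?L \<longleftrightarrow> ?R")
    proof
      assume ?L
      then obtain s m where p: "B.lt (s, m) (t, 0)"
        and Q: "\<And>q. B.lt (s, m) q \<Longrightarrow> B.lt q (t, 0) \<Longrightarrow> Q (C q)" by force
      have "Q S" if u: "A.lt s u" "A.lt u t" and "S \<in> set (tr u)" for u S
      proof -
        obtain j where "j < length (tr u)" "S = tr u ! j"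
          using \<open>S \<in> set (tr u)\<close> by (auto simp: in_set_conv_nth)
        then show ?thesis
          using Q[of "(u, j)"] p u A.lt_Field[of u t] by (auto simp: lt C_def F_def)
      qed
      then show ?R using p by (auto simp: lt)
    next
      assume ?R
      then obtain s where s: "A.lt s t"
        and Q: "\<And>u S. A.lt s u \<Longrightarrow> A.lt u t \<Longrightarrow> S \<in> set (tr u) \<Longrightarrow> Q S" by blast
      have F: "(s, length (tr s) - 1) \<in> F"
        using nonempty[of s] A.lt_Field[OF s] by (simp add: F_def)
      have "Q (C q)" if "B.lt (s, length (tr s) - 1) q" "B.lt q (t, 0)" for q
        using that Q by (cases q) (auto simp: lt C_def F_def)
      moreover have "B.lt (s, length (tr s) - 1) (t, 0)"
        using F s pos that by (simp add: lt)
      ultimately show ?L by blast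
    qed
    then show ?thesis
      by (simp add: A.eventually_before[OF that(1)] B.eventually_before[OF that(2)])
  qed
  have "computation itbm_rule P x r' C"
    unfolding computation_def
  proof (intro conjI ballI wo')
    fix p assume "p \<in> Field r'"
    then obtain t k where p: "p = (t, k)" "(t, k) \<in> F" by (cases p) (auto simp: field)
    then have tF: "t \<in> Field r" by (simp add: F_def)
    have hd: "C (t, 0) = hd (tr t)"
      using nonempty[OF tF] by (simp add: C_def hd_conv_nth)
    show "underS r' p = {} \<longrightarrow> C p = initial x"
      using min_iff[OF p(2)] start[OF tF] hd p by auto
    show "\<forall>s. pred_time r' s p \<longrightarrow> \<not> halted P (C s) \<and> exec (P ! pc (C s)) (C s) = Some (C p)"
    proof (intro allI impI)
      fix q assume q: "pred_time r' q p"
      have "step P (C q) (C p)"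
      proof (cases k)
        case 0
        then obtain s where s: "pred_time r s t" "q = (s, length (tr s) - 1)"
          using pred_outer[of q t] q p by auto
        then have "tr s \<noteq> []"
          using nonempty A.lt_Field by (auto simp: A.pred_time_lt)
        then show ?thesis
          using outer[OF s(1)] hd 0 p s(2) by (simp add: C_def last_conv_nth)
      next
        case (Suc l)
        then show ?thesis
          using pred_inner[of t l q] q p inner[of t l] by (simp add: F_def C_def)
      qed
      then show "\<not> halted P (C q) \<and> exec (P ! pc (C q)) (C q) = Some (C p)"
        by (simp add: step_def)
    qed
    show "limit_time r' p \<longrightarrow>
        enat (pc (C p)) = Liminf (before r' p) (\<lambda>s. enat (pc (C s))) \<and>
        (\<forall>i. itbm_rule (before r' p) (\<lambda>s. regs (C s) i) (regs (C p) i))"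
    proof (intro impI conjI allI)
      assume l': "limit_time r' p"
      with lim_iff p have k: "k = 0" and l: "limit_time r t" by auto
      have p0: "p = (t, 0)" using p k by simp
      note ev' = ev[OF l l'[unfolded p0] tF]
      show "enat (pc (C p)) = Liminf (before r' p) (\<lambda>s. enat (pc (C s)))"
      proof (rule antisym)
        show "enat (pc (C p)) \<le> Liminf (before r' p) (\<lambda>s. enat (pc (C s)))"
          using ev'[of "\<lambda>S. pc (hd (tr t)) \<le> pc S"] pc_le[OF l tF]
          by (intro Liminf_bounded) (simp add: p0 hd)
        show "Liminf (before r' p) (\<lambda>s. enat (pc (C s))) \<le> enat (pc (C p))"
        proof (rule ccontr)
          assume "\<not> ?thesis"
          then have "\<forall>\<^sub>F s in before r' p. enat (pc (C p)) < enat (pc (C s))"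
            by (intro less_LiminfD) simp
          then have "\<forall>\<^sub>F s in before r t. \<forall>S \<in> set (tr s). pc (hd (tr t)) < pc S"
            using ev'[of "\<lambda>S. pc (hd (tr t)) < pc S"] by (simp add: p0 hd)
          with pc_ge[OF l tF] show False
            unfolding frequently_def by (auto simp: not_le)
        qed
      qed
      fix i
      show "itbm_rule (before r' p) (\<lambda>s. regs (C s) i) (regs (C p) i)"
        unfolding itbm_rule_def tendsto_iff
        using ev'[of "\<lambda>S. dist (regs S i) (regs (hd (tr t)) i) < e" for e] lim[OF l tF]
        by (simp add: p0 hd)
    qed
  qed
  moreover have "\<exists>p \<in> Field r'. (\<forall>q \<in> Field r'. (q, p) \<in> r') \<and> halted P (C p) \<and> regs (C p) 0 = y"
  proof (intro bexI conjI ballI)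
    have ne: "tr T \<noteq> []" using nonempty T(1) by blast
    let ?p = "(T, length (tr T) - 1)"
    show p: "?p \<in> Field r'" using ne T(1) by (simp add: field F_def)
    show "halted P (C ?p)" "regs (C ?p) 0 = y"
      using T ne by (simp_all add: C_def last_conv_nth)
    fix q assume q: "q \<in> Field r'"
    then show "(q, ?p) \<in> r'"
      using p T(2) unfolding field by (cases q) (auto simp: r'_def A.lt_def F_def)
  qed
  ultimately have "halting_computation itbm_rule P x y r' C"
    by (simp add: halting_computation_def)
  then show ?thesis
    by (rule halts_with_any_time)
qed

section \<open>The simulating program\<close>

text \<open>
  The value \<open>v\<close> of \<open>R\<^sub>i\<close> is kept as \<open>a = 1 / (1 + v\<^sup>2)\<close> in \<open>reg_a i\<close> and
  \<open>b = v / (1 + v\<^sup>2)\<close> in \<open>reg_b i\<close>, so that \<open>v = b / a\<close>.  In \<open>reg_t i\<close> the new value of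
  \<open>b\<close> is prepared while the old pair is still needed; there is one such register for each
  \<open>i\<close>, since a single shared scratch register would not converge at limits.
\<close>

definition reg_a :: "nat \<Rightarrow> nat" where "reg_a i = Suc (3 * i)"
definition reg_b :: "nat \<Rightarrow> nat" where "reg_b i = Suc (Suc (3 * i))"
definition reg_t :: "nat \<Rightarrow> nat" where "reg_t i = Suc (Suc (Suc (3 * i)))"

text \<open>Register 0 lies outside the coding: it keeps the input until the output overwrites
  it.\<close>

definition pack :: "real \<Rightarrow> (nat \<Rightarrow> real) \<Rightarrow> (nat \<Rightarrow> real) \<Rightarrow> (nat \<Rightarrow> real) \<Rightarrow> nat \<Rightarrow> real" where
  "pack x a b t j = (case j of 0 \<Rightarrow> x
     | Suc l \<Rightarrow> (if l mod 3 = 0 then a else if l mod 3 = 1 then b else t) (l div 3))"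

lemma pack_simps [simp]:
  "pack x a b t 0 = x" "pack x a b t (reg_a i) = a i"
  "pack x a b t (reg_b i) = b i" "pack x a b t (reg_t i) = t i"
proof -
  have "Suc (Suc (3 * i)) div 3 = i" "Suc (Suc (3 * i)) mod 3 = 2"
    "Suc (3 * i) div 3 = i" "Suc (3 * i) mod 3 = 1"
    by presburger+
  then show "pack x a b t 0 = x" "pack x a b t (reg_a i) = a i"
    "pack x a b t (reg_b i) = b i" "pack x a b t (reg_t i) = t i"
    by (simp_all add: pack_def reg_a_def reg_b_def reg_t_def)
qed

lemma reg_cases:
  obtains "j = 0" | i where "j = reg_a i" | i where "j = reg_b i" | i where "j = reg_t i"
proof -
  have "j = 0 \<or> j = reg_a ((j - 1) div 3) \<or> j = reg_b ((j - 1) div 3) \<or> j = reg_t ((j - 1) div 3)"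
    unfolding reg_a_def reg_b_def reg_t_def by presburger
  then show ?thesis using that by blast
qed

lemma reg_distinct [simp]:
  "reg_a i = reg_a j \<longleftrightarrow> i = j" "reg_b i = reg_b j \<longleftrightarrow> i = j" "reg_t i = reg_t j \<longleftrightarrow> i = j"
  "reg_a i \<noteq> reg_b j" "reg_a i \<noteq> reg_t j" "reg_b i \<noteq> reg_a j" "reg_b i \<noteq> reg_t j" "reg_t i \<noteq> reg_a j" "reg_t i \<noteq> reg_b j"
  "reg_a i \<noteq> 0" "reg_b i \<noteq> 0" "reg_t i \<noteq> 0" "0 \<noteq> reg_a i" "0 \<noteq> reg_b i" "0 \<noteq> reg_t i"
  unfolding reg_a_def reg_b_def reg_t_def by presburger+

lemma pack_eqI:
  assumes "f 0 = x" "\<And>i. f (reg_a i) = a i" "\<And>i. f (reg_b i) = b i" "\<And>i. f (reg_t i) = t i"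
  shows "f = pack x a b t"
proof
  fix j
  show "f j = pack x a b t j"
    by (cases j rule: reg_cases) (simp_all add: assms)
qed

lemma pack_upd [simp]:
  "(pack x a b t)(0 := v) = pack v a b t"
  "(pack x a b t)(reg_a i := v) = pack x (a(i := v)) b t"
  "(pack x a b t)(reg_b i := v) = pack x a (b(i := v)) t"
  "(pack x a b t)(reg_t i := v) = pack x a b (t(i := v))"
  by (rule pack_eqI; simp)+

section \<open>Arithmetic on coded values\<close>

primrec denom :: "poly_expr \<Rightarrow> poly_expr" where
  "denom (Const c) = Const 1"
| "denom (Reg i) = Reg (reg_a i)"
| "denom (Add p q) = Mult (denom p) (denom q)"
| "denom (Mult p q) = Mult (denom p) (denom q)"

primrec numer :: "poly_expr \<Rightarrow> poly_expr" where
  "numer (Const c) = Const c"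
| "numer (Reg i) = Reg (reg_b i)"
| "numer (Add p q) = Add (Mult (numer p) (denom q)) (Mult (numer q) (denom p))"
| "numer (Mult p q) = Mult (numer p) (numer q)"

primrec poly_bound :: "poly_expr \<Rightarrow> nat" where
  "poly_bound (Const c) = 0"
| "poly_bound (Reg i) = Suc i"
| "poly_bound (Add p q) = max (poly_bound p) (poly_bound q)"
| "poly_bound (Mult p q) = max (poly_bound p) (poly_bound q)"

text \<open>Putting \<open>b i / a i\<close> for the registers makes \<open>p\<close> a fraction of
  polynomials in the pairs. Its denominator is a product of ones and nonzero \<open>a i\<close>, so
  it does not vanish.\<close>

lemma poly_val_numer_denom:
  assumes "\<And>i. i < n \<Longrightarrow> a i \<noteq> 0 \<and> R i = b i / a i" "poly_bound p \<le> n"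
  shows "poly_val (denom p) (pack x a b t) \<noteq> 0 \<and>
    poly_val (numer p) (pack x a b t) / poly_val (denom p) (pack x a b t) = poly_val p R"
  using assms(2)
proof (induction p)
  case (Add p q)
  then show ?case
    by (auto simp flip: add_frac_eq simp: add_frac_eq)
next
  case (Mult p q)
  then show ?case
    by (auto simp flip: times_divide_times_eq)
qed (use assms(1) in auto)

primrec instr_bound :: "instr \<Rightarrow> nat" where
  "instr_bound (Assign i p q) = max (Suc i) (max (poly_bound p) (poly_bound q))"
| "instr_bound (Branch i k l) = Suc i"

text \<open>The sum is a convenient upper bound for the maximum; \<open>Suc\<close> ensures that the
  input and output register 0 is coded even for the empty program.\<close>

definition num_regs :: "program \<Rightarrow> nat" where
  "num_regs P = Suc (\<Sum>ins\<leftarrow>P. instr_bound ins)"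

lemma instr_bound_le: "ins \<in> set P \<Longrightarrow> instr_bound ins \<le> num_regs P"
  unfolding num_regs_def using member_le_sum_list[of "instr_bound ins" "map instr_bound P"] by auto

lemma num_regs_pos [simp]: "0 < num_regs P"
  by (simp add: num_regs_def)

text \<open>Two lines normalise each register, and three are reserved for the instruction.\<close>

definition block_length :: "program \<Rightarrow> nat" where "block_length P = 2 * num_regs P + 3"

text \<open>
  The entry of block \<open>k\<close> is the least line of that block and the blocks are in the order of the
  lines of \<open>P\<close>, so an inferior limit of simulating lines is again an entry.  All halting line
  numbers of \<open>P\<close> share the block \<open>length P\<close>, which writes the output.
\<close>

definition base :: "program \<Rightarrow> nat \<Rightarrow> nat" where "base P k = 3 + block_length P * min k (length P)"

section \<open>Code of the blocks\<close>

definition ratio_num :: "poly_expr \<Rightarrow> poly_expr \<Rightarrow> poly_expr" where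
  "ratio_num p q = Mult (numer p) (denom q)"
definition ratio_den :: "poly_expr \<Rightarrow> poly_expr \<Rightarrow> poly_expr" where
  "ratio_den p q = Mult (denom p) (numer q)"
definition sq_sum :: "poly_expr \<Rightarrow> poly_expr \<Rightarrow> poly_expr" where
  "sq_sum p q = Add (Mult p p) (Mult q q)"

text \<open>The new value is \<open>v = N / D\<close>, so its pair is
  \<open>D^2 / (N^2 + D^2)\<close> and \<open>N * D / (N^2 + D^2)\<close>. It is computed directly,
  because a register holding \<open>v\<close> itself could be unbounded before a limit. A branch may
  test \<open>reg_b\<close>, which has the sign of the simulated register.\<close>

fun action :: "program \<Rightarrow> instr \<Rightarrow> nat \<Rightarrow> instr" where
  "action P (Assign i p q) m =
    (let N = ratio_num p q; D = ratio_den p q in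
     if m = 0 then Assign (reg_t i) (Mult N D) (sq_sum N D)
     else if m = 1 then Assign (reg_a i) (Mult D D) (sq_sum N D)
     else Assign (reg_b i) (Reg (reg_t i)) (Const 1))"
| "action P (Branch i k l) m = Branch (reg_b i) (base P k) (base P l)"

text \<open>After a limit the pair is \<open>(0, 0)\<close> if \<open>R\<^sub>i\<close> diverged; this replaces it by the code of 0.\<close>

definition normalise :: "nat \<Rightarrow> nat \<Rightarrow> instr" where
  "normalise \<beta> j =
    (if even j then Branch (reg_a (j div 2)) (Suc (Suc (\<beta> + j))) (Suc (\<beta> + j))
     else Assign (reg_a (j div 2)) (Const 1) (Const 1))"

definition code :: "program \<Rightarrow> nat \<Rightarrow> nat \<Rightarrow> instr" where
  "code P k j =
    (if j < 2 * num_regs P then normalise (base P k) j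
     else if k < length P then action P (P ! k) (j - 2 * num_regs P)
     else Assign 0 (Reg (reg_b 0)) (Reg (reg_a 0)))"

definition one_plus_sq :: poly_expr where
  "one_plus_sq = Add (Const 1) (Mult (Reg 0) (Reg 0))"

definition line :: "program \<Rightarrow> nat \<Rightarrow> instr" where
  "line P l =
    (if l = 0 then Assign (reg_a 0) (Const 1) one_plus_sq
     else if l = 1 then Assign (reg_b 0) (Reg 0) one_plus_sq
     else if l = 2 then Assign (reg_t 0) (Reg (reg_b 0)) (Const 1)
     else code P ((l - 3) div block_length P) ((l - 3) mod block_length P))"

text \<open>The exit block is cut off after its output line, so that the machine halts right after
  writing the output.\<close>

definition compile :: "program \<Rightarrow> program" where
  "compile P = map (line P) [0..<Suc (base P (length P) + 2 * num_regs P)]"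

section \<open>Lines, denominators and single steps of the compiled program\<close>

lemma line_base:
  assumes "j < block_length P" "k \<le> length P"
  shows "line P (base P k + j) = code P k j"
  using assms by (simp add: line_def base_def div_mult_self4 mult.commute)

lemma bss_compile:
  assumes "bss_program P"
  shows "bss_program (compile P)"
proof -
  have nz: "\<exists>R. poly_val q R \<noteq> 0" if l: "line P l = Assign i p q" for l i p q
  proof -
    have ops: "poly_val one_plus_sq (\<lambda>_. 0) \<noteq> 0"
      by (simp add: one_plus_sq_def)
    have sq: "\<exists>R. poly_val (sq_sum (ratio_num p' q') (ratio_den p' q')) R \<noteq> 0"
      if A: "Assign i' p' q' \<in> set P" for i' p' q'
    proof -
      obtain R where R: "poly_val q' R \<noteq> 0"
        using A assms unfolding bss_program_def by blast
      \<comment> \<open>With every \<open>a i = 1\<close> and \<open>b = R\<close> the pairs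
        represent \<open>R\<close>, so \<open>numer q'\<close> is nonzero along with
        \<open>q'\<close>; then \<open>D\<close> and \<open>N^2 + D^2\<close> are nonzero
        too.\<close>
      let ?S = "pack 0 (\<lambda>_. 1) R R"
      note f = poly_val_numer_denom[where n = "max (poly_bound p') (poly_bound q')" and a = "\<lambda>_. 1"
          and b = R and R = R and x = 0 and t = R]
      have "poly_val (denom p') ?S \<noteq> 0" "poly_val (numer q') ?S \<noteq> 0"
        using f[of p'] f[of q'] R by auto
      then have "poly_val (sq_sum (ratio_num p' q') (ratio_den p' q')) ?S \<noteq> 0"
        by (simp add: sq_sum_def ratio_den_def sum_squares_eq_zero_iff)
      then show ?thesis by (intro exI[of _ ?S])
    qed
    have act: "\<exists>R. poly_val q R \<noteq> 0" if "action P ins m = Assign i p q" "ins \<in> set P" for ins m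
    proof (cases ins)
      case (Assign i' p' q')
      have "q = sq_sum (ratio_num p' q') (ratio_den p' q') \<or> q = Const 1"
        using that(1) by (auto simp: Assign Let_def split: if_splits)
      then show ?thesis using sq[of i' p' q'] that(2) Assign by auto
    qed (use that in auto)
    consider "q = one_plus_sq" | "q = Const 1" | "q = Reg (reg_a 0)"
      | ins m where "action P ins m = Assign i p q" "ins \<in> set P"
      using l by (auto simp: line_def code_def normalise_def split: if_splits)
    then show ?thesis
    proof cases
      case 3
      then show ?thesis by (intro exI[of _ "\<lambda>_. 1"]) simp
    qed (use ops act in auto)
  qed
  show ?thesis
    by (auto simp: bss_program_def compile_def simp del: upt_Suc dest!: nz[OF sym])
qed

lemma step_compile:
  assumes "k \<le> length P" "j < block_length P" "k = length P \<Longrightarrow> j \<le> 2 * num_regs P"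
  shows "step (compile P) (Snapshot \<rho> (base P k + j)) S' \<longleftrightarrow>
    exec (code P k j) (Snapshot \<rho> (base P k + j)) = Some S'"
proof -
  have "base P k + j < Suc (base P (length P) + 2 * num_regs P)"
  proof (cases "k = length P")
    case False
    then have "block_length P * Suc k \<le> block_length P * length P"
      using assms(1) by (intro mult_le_mono2) simp
    then show ?thesis
      using assms(1,2) by (simp add: base_def)
  qed (use assms(3) in simp)
  then show ?thesis
    using line_base[OF assms(2,1)] by (simp add: step_def halted_def compile_def del: upt_Suc)
qed

section \<open>Simulating one instruction\<close>

definition coord_a :: "real \<Rightarrow> real" where "coord_a v = 1 / (1 + v\<^sup>2)"
definition coord_b :: "real \<Rightarrow> real" where "coord_b v = v / (1 + v\<^sup>2)"

lemma one_plus_sq_pos: "0 < 1 + (v::real)\<^sup>2"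
  by (simp add: add_pos_nonneg)

lemma coord_a_pos: "0 < coord_a v"
  by (simp add: coord_a_def one_plus_sq_pos)

lemma coord_b_pos_iff: "0 < coord_b v \<longleftrightarrow> 0 < v"
  using one_plus_sq_pos[of v] by (auto simp: coord_b_def zero_less_divide_iff)

lemma coord_0 [simp]: "coord_a 0 = 1" "coord_b 0 = 0"
  by (simp_all add: coord_a_def coord_b_def)

lemma coord_ratio: "coord_b v / coord_a v = v"
  using one_plus_sq_pos[of v] by (simp add: coord_a_def coord_b_def)

text \<open>Indices \<open>i \<ge> n\<close> are never coded and keep the initial content 0. Between
  instructions \<open>reg_t i\<close> agrees with \<open>reg_b i\<close>, so both converge together
  at limits.\<close>

definition encoding :: "real \<Rightarrow> nat \<Rightarrow> (nat \<Rightarrow> real) \<Rightarrow> nat \<Rightarrow> real" where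
  "encoding x n R = pack x (\<lambda>i. if i < n then coord_a (R i) else 0)
     (\<lambda>i. if i < n then coord_b (R i) else 0) (\<lambda>i. if i < n then coord_b (R i) else 0)"

text \<open>Induction on the number \<open>j\<close> of registers already treated; the even line
  skips the odd one exactly if \<open>reg_a\<close> is positive. Each \<open>reg_a i\<close> changes
  at most once, so every register holds its first or its last value throughout, which the limit
  argument relies on.\<close>

lemma chain_normalise:
  assumes k: "k \<le> length P"
    and a: "\<And>i. i < num_regs P \<Longrightarrow> a i = e i \<or> a i = 0 \<and> e i = 1"
    and e: "\<And>i. (0::real) < e i"
    and j: "j \<le> num_regs P"
  shows "\<exists>xs. (0 < j \<longrightarrow> xs \<noteq> []) \<and>
    chain (compile P) (Snapshot (pack x a b t) (base P k)) xs
      (Snapshot (pack x (\<lambda>i. if i < j then e i else a i) b t) (base P k + 2 * j)) \<and>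
    (\<forall>S \<in> set xs. base P k \<le> pc S \<and>
      (\<forall>l. regs S l \<in> {pack x a b t l, pack x (\<lambda>i. if i < num_regs P then e i else a i) b t l}))"
  using j
proof (induction j)
  case 0
  then show ?case by (intro exI[of _ "[]"]) simp
next
  case (Suc j)
  let ?a = "\<lambda>j i. if i < j then e i else a i"
  let ?S = "\<lambda>j. Snapshot (pack x (?a j) b t) (base P k + 2 * j)"
  have val: "regs S l \<in> {pack x a b t l, pack x (?a (num_regs P)) b t l}"
    if "regs S = pack x (?a j') b t" "j' \<le> num_regs P" for S j' l
    using that by (cases l rule: reg_cases) auto
  obtain xs where xs: "0 < j \<longrightarrow> xs \<noteq> []"
    "chain (compile P) (Snapshot (pack x a b t) (base P k)) xs (?S j)"
    "\<forall>S \<in> set xs. base P k \<le> pc S \<and> (\<forall>l. regs S l \<in> {pack x a b t l, pack x (?a (num_regs P)) b t l})"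
    using Suc by auto
  have j: "2 * j < 2 * num_regs P" "Suc (2 * j) < 2 * num_regs P" "2 * num_regs P < block_length P"
    using Suc.prems by (auto simp: block_length_def)
  have s0: "step (compile P) (?S j) S' \<longleftrightarrow>
      S' = Snapshot (pack x (?a j) b t) (base P k + 2 * j + (if 0 < a j then 2 else 1))" for S'
    using step_compile[OF k, of "2 * j" "pack x (?a j) b t" S'] j
    by (auto simp: code_def normalise_def)
  show ?case
  proof (cases "a j = e j")
    case True
    then have same: "?a j = ?a (Suc j)" by (auto simp: less_Suc_eq)
    have "chain (compile P) (?S j) [?S j] (?S (Suc j))"
      using s0 e[of j] True by (simp add: same)
    then have "chain (compile P) (Snapshot (pack x a b t) (base P k)) (xs @ [?S j]) (?S (Suc j))"
      using xs(2) by (rule chain_append[rotated])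
    then show ?thesis
      using xs(3) val[of "?S j" j] Suc.prems
      by (intro exI[of _ "xs @ [?S j]"]) auto
  next
    case False
    with a[of j] Suc.prems have aj: "a j = 0" "e j = 1" by auto
    let ?M = "Snapshot (pack x (?a j) b t) (Suc (base P k + 2 * j))"
    have "step (compile P) ?M S' \<longleftrightarrow>
        S' = Snapshot (pack x ((?a j)(j := 1)) b t) (Suc (Suc (base P k + 2 * j)))" for S'
      using step_compile[OF k, of "Suc (2 * j)" "pack x (?a j) b t" S'] j
      by (auto simp: code_def normalise_def)
    moreover have "(?a j)(j := 1) = ?a (Suc j)"
      using aj by (auto simp: less_Suc_eq)
    ultimately have "chain (compile P) (?S j) [?S j, ?M] (?S (Suc j))"
      using s0 aj by simp
    then have "chain (compile P) (Snapshot (pack x a b t) (base P k)) (xs @ [?S j, ?M]) (?S (Suc j))"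
      using xs(2) by (rule chain_append[rotated])
    then show ?thesis
      using xs(3) val[of "?S j" j] val[of ?M j] Suc.prems
      by (intro exI[of _ "xs @ [?S j, ?M]"]) auto
  qed
qed

text \<open>From \<open>N = v * D\<close> follows \<open>N^2 + D^2 = D^2 * (1 + v^2)\<close>, and
  \<open>D^2\<close> cancels.\<close>

lemma ratio_vals:
  assumes N: "poly_val N \<rho> = v * poly_val D \<rho>" and D: "poly_val D \<rho> \<noteq> 0"
  shows "poly_val (sq_sum N D) \<rho> \<noteq> 0"
    "poly_val N \<rho> * poly_val D \<rho> / poly_val (sq_sum N D) \<rho> = coord_b v"
    "poly_val D \<rho> * poly_val D \<rho> / poly_val (sq_sum N D) \<rho> = coord_a v"
proof -
  let ?d = "poly_val D \<rho>"
  have s: "poly_val (sq_sum N D) \<rho> = (?d * ?d) * (1 + v\<^sup>2)"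
    by (simp add: sq_sum_def N algebra_simps power2_eq_square)
  then show "poly_val (sq_sum N D) \<rho> \<noteq> 0"
    using D one_plus_sq_pos[of v] by simp
  show "poly_val N \<rho> * ?d / poly_val (sq_sum N D) \<rho> = coord_b v"
    "?d * ?d / poly_val (sq_sum N D) \<rho> = coord_a v"
    unfolding s N using D one_plus_sq_pos[of v] by (simp_all add: coord_a_def coord_b_def)
qed

text \<open>An assignment writes each of \<open>reg_t i\<close>, \<open>reg_a i\<close>,
  \<open>reg_b i\<close> just once and a branch writes nothing, so every register holds its old or
  its new value.\<close>

lemma chain_action:
  assumes k: "k < length P" and ex: "exec (P ! k) (Snapshot R k) = Some S'"
  shows "\<exists>xs. chain (compile P) (Snapshot (encoding x (num_regs P) R) (base P k + 2 * num_regs P)) xs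
      (Snapshot (encoding x (num_regs P) (regs S')) (base P (pc S'))) \<and>
    (\<forall>S \<in> set xs. base P k \<le> pc S \<and>
      (\<forall>l. regs S l \<in> {encoding x (num_regs P) R l, encoding x (num_regs P) (regs S') l}))"
proof -
  let ?n = "num_regs P" and ?pc = "base P k + 2 * num_regs P"
  define A where "A = (\<lambda>i. if i < ?n then coord_a (R i) else 0)"
  define B where "B = (\<lambda>i. if i < ?n then coord_b (R i) else 0)"
  have encoding: "encoding x ?n R = pack x A B B"
    by (simp add: encoding_def A_def B_def)
  have bound: "instr_bound (P ! k) \<le> ?n"
    using k by (intro instr_bound_le) simp
  have st: "step (compile P) (Snapshot \<rho> (?pc + m)) S \<longleftrightarrow>
      exec (action P (P ! k) m) (Snapshot \<rho> (?pc + m)) = Some S" if "m < 3" for \<rho> m S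
    using step_compile[of k P "2 * ?n + m" \<rho> S] k that by (simp add: block_length_def code_def add.assoc)
  note st0 = st[of 0, simplified] and st1 = st[of 1, simplified] and st2 = st[of 2, simplified]
  show ?thesis
  proof (cases "P ! k")
    case (Assign i p q)
    have i: "i < ?n" "poly_bound p \<le> ?n" "poly_bound q \<le> ?n"
      using bound by (auto simp: Assign)
    define v where "v = poly_val p R / poly_val q R"
    have q: "poly_val q R \<noteq> 0" and S': "S' = Snapshot (R(i := v)) (Suc k)"
      using ex by (auto simp: Assign v_def split: if_splits)
    let ?N = "ratio_num p q" and ?D = "ratio_den p q"
    \<comment> \<open>Stated for all \<open>t\<close>: the second line computes from the same
      \<open>N\<close> and \<open>D\<close> although \<open>reg_t i\<close> has already
      changed.\<close>
    have ND: "poly_val ?D (pack x A B t) \<noteq> 0 \<and>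
        poly_val ?N (pack x A B t) = v * poly_val ?D (pack x A B t)" for t
    proof -
      have AR: "A i \<noteq> 0 \<and> R i = B i / A i" if "i < ?n" for i
        using that coord_a_pos[of "R i"] coord_ratio[of "R i"] by (simp add: A_def B_def)
      have f: "poly_val (denom e) (pack x A B t) \<noteq> 0 \<and>
          poly_val (numer e) (pack x A B t) / poly_val (denom e) (pack x A B t) = poly_val e R"
        if "poly_bound e \<le> ?n" for e
        by (rule poly_val_numer_denom[OF _ that]) (rule AR)
      note p' = f[OF i(2)] and q' = f[OF i(3)]
      have "poly_val (numer q) (pack x A B t) \<noteq> 0" using q' q by auto
      moreover have "v = (poly_val (numer p) (pack x A B t) / poly_val (denom p) (pack x A B t)) /
          (poly_val (numer q) (pack x A B t) / poly_val (denom q) (pack x A B t))"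
        unfolding v_def conjunct2[OF p'] conjunct2[OF q'] ..
      ultimately show ?thesis
        using conjunct1[OF p'] conjunct1[OF q'] by (simp add: ratio_num_def ratio_den_def)
    qed
    let ?t = "B(i := coord_b v)" and ?a = "A(i := coord_a v)"
    let ?S = "\<lambda>a b t m. Snapshot (pack x a b t) (?pc + m)"
    have final: "encoding x ?n (regs S') = pack x ?a ?t ?t"
      using i(1) by (intro pack_eqI) (auto simp: S' encoding_def A_def B_def)
    have s0: "step (compile P) (?S A B B 0) (?S A B ?t 1)"
      using ratio_vals[of ?N "pack x A B B" v ?D] ND by (simp add: st0 Assign Let_def)
    have s1: "step (compile P) (?S A B ?t 1) (?S ?a B ?t 2)"
      using ratio_vals[of ?N "pack x A B ?t" v ?D] ND by (simp add: st1 Assign Let_def)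
    have s2: "step (compile P) (?S ?a B ?t 2) (?S ?a ?t ?t 3)"
      by (simp add: st2 Assign Let_def)
    \<comment> \<open>The three action lines end exactly at the entry of the next block.\<close>
    have pc': "base P (pc S') = ?pc + 3"
      using k by (simp add: S' base_def block_length_def)
    have "chain (compile P) (?S A B B 0) [?S A B B 0, ?S A B ?t 1, ?S ?a B ?t 2] (?S ?a ?t ?t 3)"
      using s0 s1 s2 by auto
    moreover have "pack x a b t l \<in> {pack x A B B l, pack x ?a ?t ?t l}"
      if "a \<in> {A, ?a}" "b \<in> {B, ?t}" "t \<in> {B, ?t}" for a b t l
      using that by (cases l rule: reg_cases) auto
    ultimately show ?thesis
      unfolding encoding final pc'
      by (intro exI[of _ "[?S A B B 0, ?S A B ?t 1, ?S ?a B ?t 2]"]) simp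
  next
    case (Branch i k1 k2)
    have "i < ?n" using bound by (simp add: Branch)
    then have "step (compile P) (Snapshot (encoding x ?n R) ?pc)
        (Snapshot (encoding x ?n (regs S')) (base P (pc S')))"
      using ex by (auto simp: st0 Branch encoding B_def coord_b_pos_iff)
    then show ?thesis
      by (intro exI[of _ "[Snapshot (encoding x ?n R) ?pc]"]) simp
  qed
qed

text \<open>\<open>\<rho>\<close> codes \<open>R\<close>, where the pair \<open>(0, 0)\<close> also stands for 0.\<close>

definition encodes :: "nat \<Rightarrow> (nat \<Rightarrow> real) \<Rightarrow> (nat \<Rightarrow> real) \<Rightarrow> bool" where
  "encodes n R \<rho> \<longleftrightarrow> (\<exists>x a. \<rho> = pack x a (\<lambda>i. if i < n then coord_b (R i) else 0)
      (\<lambda>i. if i < n then coord_b (R i) else 0) \<and>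
    (\<forall>i. if i < n then a i = coord_a (R i) \<or> a i = 0 \<and> R i = 0 else a i = 0))"

lemma chain_normalise_encodes:
  assumes k: "k \<le> length P" and w: "encodes (num_regs P) R \<rho>"
  shows "\<exists>xs. xs \<noteq> [] \<and>
    chain (compile P) (Snapshot \<rho> (base P k)) xs
      (Snapshot (encoding (\<rho> 0) (num_regs P) R) (base P k + 2 * num_regs P)) \<and>
    (\<forall>S \<in> set xs. base P k \<le> pc S \<and> (\<forall>l. regs S l \<in> {\<rho> l, encoding (\<rho> 0) (num_regs P) R l}))"
proof -
  let ?B = "\<lambda>i. if i < num_regs P then coord_b (R i) else 0"
  obtain x a where \<rho>: "\<rho> = pack x a ?B ?B"
    and a: "\<And>i. if i < num_regs P then a i = coord_a (R i) \<or> a i = 0 \<and> R i = 0 else a i = 0"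
    using w unfolding encodes_def by blast
  have "(\<lambda>i. if i < num_regs P then coord_a (R i) else a i) = (\<lambda>i. if i < num_regs P then coord_a (R i) else 0)"
    using a by (auto simp: fun_eq_iff split: if_splits)
  then have encoding: "encoding (\<rho> 0) (num_regs P) R = pack x (\<lambda>i. if i < num_regs P then coord_a (R i) else a i) ?B ?B"
    by (simp add: encoding_def \<rho>)
  have "a i = coord_a (R i) \<or> a i = 0 \<and> coord_a (R i) = 1" if "i < num_regs P" for i
    using a[of i] that by auto
  from chain_normalise[OF k this coord_a_pos order_refl, where b = ?B and t = ?B and x = x]
  show ?thesis unfolding encoding by (simp add: \<rho>)
qed

lemma chain_block:
  assumes k: "k < length P" and ex: "exec (P ! k) (Snapshot R k) = Some S'"
    and w: "encodes (num_regs P) R \<rho>"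
  shows "\<exists>xs. xs \<noteq> [] \<and>
    chain (compile P) (Snapshot \<rho> (base P k)) xs
      (Snapshot (encoding (\<rho> 0) (num_regs P) (regs S')) (base P (pc S'))) \<and>
    (\<forall>S \<in> set xs. base P k \<le> pc S \<and> (\<forall>l. regs S l \<in>
      {\<rho> l, encoding (\<rho> 0) (num_regs P) R l, encoding (\<rho> 0) (num_regs P) (regs S') l}))"
proof -
  obtain xs where xs: "xs \<noteq> []"
    "chain (compile P) (Snapshot \<rho> (base P k)) xs
      (Snapshot (encoding (\<rho> 0) (num_regs P) R) (base P k + 2 * num_regs P))"
    "\<forall>S \<in> set xs. base P k \<le> pc S \<and> (\<forall>l. regs S l \<in> {\<rho> l, encoding (\<rho> 0) (num_regs P) R l})"
    using chain_normalise_encodes[OF less_imp_le[OF k] w] by blast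
  obtain ys where ys:
    "chain (compile P) (Snapshot (encoding (\<rho> 0) (num_regs P) R) (base P k + 2 * num_regs P)) ys
      (Snapshot (encoding (\<rho> 0) (num_regs P) (regs S')) (base P (pc S')))"
    "\<forall>S \<in> set ys. base P k \<le> pc S \<and>
      (\<forall>l. regs S l \<in> {encoding (\<rho> 0) (num_regs P) R l, encoding (\<rho> 0) (num_regs P) (regs S') l})"
    using chain_action[OF k ex, of "\<rho> 0"] by blast
  show ?thesis
    using chain_append[OF xs(2) ys(1)] xs(1,3) ys(2)
    by (intro exI[of _ "xs @ ys"]) auto
qed

text \<open>After normalising, \<open>a > 0\<close>, so the output line can divide and recovers the
  value \<open>b / a\<close>.\<close>

lemma chain_exit:
  assumes k: "length P \<le> k" and w: "encodes (num_regs P) R \<rho>"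
  shows "\<exists>xs S. chain (compile P) (Snapshot \<rho> (base P k)) xs S \<and>
    halted (compile P) S \<and> regs S 0 = R 0"
proof -
  have base: "base P k = base P (length P)" using k by (simp add: base_def)
  let ?\<rho> = "encoding (\<rho> 0) (num_regs P) R" and ?pc = "base P (length P) + 2 * num_regs P"
  obtain xs where xs: "chain (compile P) (Snapshot \<rho> (base P k)) xs (Snapshot ?\<rho> ?pc)"
    using chain_normalise_encodes[OF order_refl w] base by metis
  have "step (compile P) (Snapshot ?\<rho> ?pc) (Snapshot (?\<rho>(0 := R 0)) (Suc ?pc))"
    using step_compile[of "length P" P "2 * num_regs P" ?\<rho>] coord_a_pos[of "R 0"] coord_ratio[of "R 0"]
    by (simp add: block_length_def code_def encoding_def)
  then have "chain (compile P) (Snapshot ?\<rho> ?pc) [Snapshot ?\<rho> ?pc]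
      (Snapshot (?\<rho>(0 := R 0)) (Suc ?pc))"
    by simp
  from chain_append[OF xs this] show ?thesis
    by (intro exI conjI) (auto simp: halted_def compile_def)
qed

text \<open>Only the input needs to be coded: all other pairs are still \<open>(0, 0)\<close>, which
  is read as 0.\<close>

lemma chain_entry:
  "\<exists>xs \<rho>. xs \<noteq> [] \<and> chain (compile P) (initial x) xs (Snapshot \<rho> (base P 0)) \<and>
    \<rho> 0 = x \<and> encodes (num_regs P) ((\<lambda>_. 0)(0 := x)) \<rho>"
proof -
  let ?z = "\<lambda>_::nat. 0::real"
  let ?a = "?z(0 := coord_a x)" and ?b = "?z(0 := coord_b x)"
  have ini: "initial x = Snapshot (pack x ?z ?z ?z) 0"
    by (auto simp: initial_def intro!: pack_eqI)
  have len: "3 < length (compile P)"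
    by (simp add: compile_def base_def)
  have st: "step (compile P) (Snapshot \<rho> m) S \<longleftrightarrow> exec (line P m) (Snapshot \<rho> m) = Some S"
    if "m < 3" for \<rho> m S
    using that len unfolding step_def halted_def by (simp add: compile_def del: upt_Suc)
  have nz: "1 + x * x \<noteq> 0"
    using one_plus_sq_pos[of x] by (simp add: power2_eq_square)
  let ?xs = "[Snapshot (pack x ?z ?z ?z) 0, Snapshot (pack x ?a ?z ?z) 1, Snapshot (pack x ?a ?b ?z) 2]"
  have "chain (compile P) (initial x) ?xs (Snapshot (pack x ?a ?b ?b) (base P 0))"
    using nz by (simp add: ini st line_def one_plus_sq_def coord_a_def coord_b_def power2_eq_square base_def)
  moreover have "encodes (num_regs P) ((\<lambda>_. 0)(0 := x)) (pack x ?a ?b ?b)"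
    unfolding encodes_def
    by (intro exI[of _ x] exI[of _ ?a] conjI arg_cong2[where f = "pack x ?a"]) auto
  ultimately show ?thesis
    by (intro exI[of _ ?xs] exI[of _ "pack x ?a ?b ?b"]) simp
qed

section \<open>Transfinite simulation\<close>

text \<open>The least time after \<open>s\<close> is its successor.\<close>

lemma (in wo_time) ex_pred_time:
  assumes "lt s t"
  obtains u where "pred_time r s u" "u = t \<or> lt u t"
proof -
  have "\<exists>u. lt s u \<and> (\<forall>v. lt v u \<longrightarrow> \<not> lt s v)"
    using assms by (induction t rule: lt_induct) blast
  then obtain u where u: "lt s u" "\<And>v. lt v u \<Longrightarrow> \<not> lt s v"
    by blast
  then have "pred_time r s u"
    by (auto simp: pred_time_lt)
  moreover have "u = t \<or> lt u t"
    using lt_linear[of u t] u assms lt_Field by blast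
  ultimately show ?thesis using that by blast
qed

section \<open>Limits of the circle coordinates under \<open>witbm_rule\<close>\<close>

lemma witbm_rule_diverges:
  assumes "witbm_rule F f l" "\<not> (f \<longlongrightarrow> l) F"
  shows "l = 0" "filterlim f at_top F \<or> filterlim f at_bot F"
proof -
  show "l = 0" using assms by (auto simp: witbm_rule_def)
  show "filterlim f at_top F \<or> filterlim f at_bot F"
    using witbm_rule_cases[OF assms(1)] assms(2)
    by (auto simp: filterlim_at_top_dense filterlim_at_bot_dense)
qed

lemma tendsto_coords_diverges:
  assumes "filterlim f at_top F \<or> filterlim f at_bot F"
  shows "((\<lambda>s. coord_a (f s)) \<longlongrightarrow> 0) F" "((\<lambda>s. coord_b (f s)) \<longlongrightarrow> 0) F"
proof -
  have "(coord_a \<longlongrightarrow> 0) at_top" "(coord_a \<longlongrightarrow> 0) at_bot" "(coord_b \<longlongrightarrow> 0) at_top" "(coord_b \<longlongrightarrow> 0) at_bot"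
    unfolding coord_a_def coord_b_def by real_asymp+
  then show "((\<lambda>s. coord_a (f s)) \<longlongrightarrow> 0) F" "((\<lambda>s. coord_b (f s)) \<longlongrightarrow> 0) F"
    using assms filterlim_compose by blast+
qed

lemma tendsto_coords:
  assumes "(f \<longlongrightarrow> l) F"
  shows "((\<lambda>s. coord_a (f s)) \<longlongrightarrow> coord_a l) F" "((\<lambda>s. coord_b (f s)) \<longlongrightarrow> coord_b l) F"
  using one_plus_sq_pos[of l] unfolding coord_a_def coord_b_def by (intro tendsto_intros assms; simp)+

text \<open>Every time \<open>s\<close> is replaced by the finite run of the block simulating the
  instruction executed at \<open>s\<close>; \<open>computation_of_traces\<close> glues these runs
  together.\<close>

lemma halts_with_compile:
  assumes "halts_with witbm_rule P x y"
  shows "halts_with itbm_rule (compile P) x y"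
proof -
  obtain r :: "nat rel" and C T where comp: "computation witbm_rule P x r C"
    and T: "T \<in> Field r" "\<And>t. t \<in> Field r \<Longrightarrow> (t, T) \<in> r" "halted P (C T)" "regs (C T) 0 = y"
    using assms by (auto simp: halts_with_def halting_computation_def)
  have wo: "Well_order r"
    using comp by (simp add: computation_def)
  interpret wo_time r by unfold_locales (rule wo)
  have C_min: "C t = initial x" if "t \<in> Field r" "underS r t = {}" for t
    using comp that by (simp add: computation_def)
  have C_pred: "\<not> halted P (C s)" "exec (P ! pc (C s)) (C s) = Some (C t)" if "pred_time r s t" for s t
    using comp that lt_Field[of s t] by (auto simp: computation_def pred_time_lt)
  have C_lim: "enat (pc (C t)) = Liminf (before r t) (\<lambda>s. enat (pc (C s)))"
    "witbm_rule (before r t) (\<lambda>s. regs (C s) i) (regs (C t) i)" if "limit_time r t" for t i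
    using comp that lt_Field[of _ t] by (auto simp: computation_def limit_time_lt)

  define n where "n = num_regs P"
  \<comment> \<open>time \<open>s\<close> is a limit at which the infinite rule sets \<open>R\<^sub>i\<close> to 0\<close>
  define reset where "reset s i \<longleftrightarrow> limit_time r s \<and>
    \<not> ((\<lambda>u. regs (C u) i) \<longlongrightarrow> regs (C s) i) (before r s)" for s i
  define B where "B s i = (if i < n then coord_b (regs (C s) i) else 0)" for s i
  define A where "A s i = (if i < n then if reset s i then 0 else coord_a (regs (C s) i) else 0)" for s i
  \<comment> \<open>\<open>\<rho> s\<close> is the content at block entry, with
    \<open>(0, 0)\<close> for every reset register; \<open>G s\<close> is the content after
    normalising.\<close>
  define \<rho> where "\<rho> s = pack x (A s) (B s) (B s)" for s
  define G where "G s = encoding x n (regs (C s))" for s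
  define start where "start s = (if underS r s = {} then initial x
    else Snapshot (\<rho> s) (base P (pc (C s))))" for s

  have reset0: "regs (C s) i = 0" if "reset s i" for s i
    using that C_lim(2) witbm_rule_diverges(1) unfolding reset_def by blast
  have encodes: "encodes n (regs (C s)) (\<rho> s)" for s
    unfolding encodes_def \<rho>_def B_def
    by (intro exI conjI, rule refl) (auto simp: A_def reset0)
  have start_succ: "start t = Snapshot (G t) (base P (pc (C t)))" if "pred_time r s t" for s t
  proof -
    have "underS r t \<noteq> {}" "\<not> limit_time r t"
      using that by (auto simp: pred_time_def limit_time_def)
    moreover have "\<rho> t = G t"
      using \<open>\<not> limit_time r t\<close> unfolding G_def encoding_def
        by (intro pack_eqI) (simp_all add: \<rho>_def A_def B_def reset_def)
    ultimately show ?thesis by (simp add: start_def)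
  qed
  \<comment> \<open>Only the minimal time has the lines coding the input in front of its
    block.\<close>
  have pre: "\<exists>xs \<rho>'. chain (compile P) (start s) xs (Snapshot \<rho>' (base P (pc (C s)))) \<and>
      \<rho>' 0 = x \<and> encodes n (regs (C s)) \<rho>' \<and> (underS r s \<noteq> {} \<longrightarrow> xs = [] \<and> \<rho>' = \<rho> s)"
    if "s \<in> Field r" for s
  proof (cases "underS r s = {}")
    case True
    then show ?thesis
      using chain_entry[of P x] C_min[OF that] by (auto simp: start_def initial_def n_def)
  next
    case False
    then show ?thesis
      using encodes[of s] by (intro exI[of _ "[]"] exI[of _ "\<rho> s"]) (simp add: start_def \<rho>_def)
  qed

  \<comment> \<open>The bounds on lines and contents are restricted to nonminimal times, as the
    lines coding the input lie below every block; limits do not see the minimal time.\<close>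
  define trace where "trace s xs \<longleftrightarrow> xs \<noteq> [] \<and> hd xs = start s \<and>
    (\<forall>m. Suc m < length xs \<longrightarrow> step (compile P) (xs ! m) (xs ! Suc m)) \<and>
    (\<forall>t. pred_time r s t \<longrightarrow> step (compile P) (last xs) (start t) \<and>
      (underS r s \<noteq> {} \<longrightarrow> (\<forall>S \<in> set xs. base P (pc (C s)) \<le> pc S \<and>
        (\<forall>l. regs S l \<in> {\<rho> s l, G s l, G t l})))) \<and>
    (s = T \<longrightarrow> halted (compile P) (last xs) \<and> regs (last xs) 0 = y)" for s xs
  have "\<exists>xs. trace s xs" if s: "s \<in> Field r" for s
  proof -
    obtain xs \<rho>' where xs: "chain (compile P) (start s) xs (Snapshot \<rho>' (base P (pc (C s))))"
      "\<rho>' 0 = x" "encodes (num_regs P) (regs (C s)) \<rho>'" "underS r s \<noteq> {} \<Longrightarrow> xs = [] \<and> \<rho>' = \<rho> s"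
      using pre[OF s] unfolding n_def by blast
    show ?thesis
    proof (cases "s = T")
      case True
      obtain ys S where ys: "chain (compile P) (Snapshot \<rho>' (base P (pc (C s)))) ys S"
        "halted (compile P) S" "regs S 0 = regs (C s) 0"
        using chain_exit[OF _ xs(3), of "pc (C s)"] T(3) True by (auto simp: halted_def)
      note ch = chain_append[OF xs(1) ys(1)]
      have "\<not> pred_time r T t" for t
        using T(2) lt_Field lt_irrefl lt_trans by (metis lt_def pred_time_lt)
      moreover have "hd (xs @ ys @ [S]) = start s"
        using chain_hd[OF ch] ch by (cases xs; cases ys) auto
      \<comment> \<open>The last time has no successor, so here the halting snapshot itself closes
        the trace.\<close>
      ultimately have "trace s (xs @ ys @ [S])"
        using chain_nth[OF ch] ys(2,3) T(4) True by (simp add: trace_def)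
      then show ?thesis ..
    next
      case False
      then have "lt s T" using T(2)[OF s] by (simp add: lt_def)
      then obtain t where t: "pred_time r s t" by (rule ex_pred_time)
      have uniq: "t' = t" if "pred_time r s t'" for t'
        using t that lt_linear[of t t'] lt_Field unfolding pred_time_lt by blast
      have ex: "exec (P ! pc (C s)) (Snapshot (regs (C s)) (pc (C s))) = Some (C t)"
        and k: "pc (C s) < length P"
        using C_pred[OF t] by (simp_all add: halted_def)
      obtain ys where ys: "ys \<noteq> []"
        "chain (compile P) (Snapshot \<rho>' (base P (pc (C s)))) ys (start t)"
        "\<forall>S \<in> set ys. base P (pc (C s)) \<le> pc S \<and> (\<forall>l. regs S l \<in> {\<rho>' l, G s l, G t l})"
        using chain_block[OF k ex xs(3)] xs(2) unfolding start_succ[OF t] G_def n_def by metis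
      note ch = chain_append[OF xs(1) ys(2)]
      have "xs @ ys \<noteq> []" using ys(1) by simp
      have st: "step (compile P) ((xs @ ys) ! m) ((xs @ ys) ! Suc m)" if "Suc m < length (xs @ ys)" for m
        using chain_nth[OF ch, of m] that by (simp add: nth_append split: if_splits)
      have la: "step (compile P) (last (xs @ ys)) (start t)"
        by (rule chain_last[OF ch \<open>xs @ ys \<noteq> []\<close>])
      have "trace s (xs @ ys)"
        unfolding trace_def
        using chain_hd[OF ch \<open>xs @ ys \<noteq> []\<close>] \<open>xs @ ys \<noteq> []\<close> st la ys(3) xs(4) uniq False
        by auto
      then show ?thesis ..
    qed
  qed
  then obtain tr where tr: "\<And>s. s \<in> Field r \<Longrightarrow> trace s (tr s)"
    by metis
  have hd_tr: "hd (tr s) = start s" and tr_ne: "tr s \<noteq> []" if "s \<in> Field r" for s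
    using tr[OF that] by (auto simp: trace_def)

  have block: "\<forall>\<^sub>F s in before r t. s \<in> Field r \<and> underS r s \<noteq> {} \<and>
      (\<exists>u. pred_time r s u \<and> lt u t)" if t: "limit_time r t" for t
  proof -
    obtain s0 where s0: "lt s0 t" using t by (auto simp: limit_time_lt)
    have "\<exists>u. pred_time r s u \<and> lt u t" if "lt s t" for s
      using ex_pred_time[OF that] t unfolding limit_time_def by metis
    then show ?thesis
      unfolding eventually_before[OF t] using s0 lt_Field by (auto simp: underS_lt)
  qed
  have tr_block: "\<forall>\<^sub>F s in before r t. \<forall>S \<in> set (tr s). base P (pc (C s)) \<le> pc S \<and>
      (\<exists>u. pred_time r s u \<and> lt u t \<and> (\<forall>l. regs S l \<in> {\<rho> s l, G s l, G u l}))"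
    if t: "limit_time r t" for t
    using block[OF t]
  proof eventually_elim
    case (elim s)
    then show ?case using tr[of s] unfolding trace_def by blast
  qed
  have start_lim: "start t = Snapshot (\<rho> t) (base P (pc (C t)))" if "limit_time r t" for t
    using that by (simp add: start_def limit_time_def)
  have not_reset: "\<forall>\<^sub>F s in before r t. \<not> reset s i" if t: "limit_time r t" for t i
  proof -
    \<comment> \<open>Before a reset to 0 there are large values, so resets cofinal in \<open>t\<close> would leave
      \<open>R\<^sub>i\<close> undefined at \<open>t\<close>.\<close>
    have big: "\<exists>u. lt s0 u \<and> lt u s \<and> \<bar>regs (C u) i\<bar> > 1" if "reset s i" "lt s0 s" for s s0
    proof -
      have s: "limit_time r s" using that(1) by (simp add: reset_def)
      have "filterlim (\<lambda>u. regs (C u) i) at_top (before r s) \<or>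
          filterlim (\<lambda>u. regs (C u) i) at_bot (before r s)"
        using that(1) C_lim(2)[OF s] witbm_rule_diverges(2) unfolding reset_def by blast
      then have "\<forall>\<^sub>F u in before r s. \<bar>regs (C u) i\<bar> > 1"
      proof
        assume "filterlim (\<lambda>u. regs (C u) i) at_top (before r s)"
        then have "\<forall>\<^sub>F u in before r s. regs (C u) i > 1"
          by (simp add: filterlim_at_top_dense)
        then show ?thesis by eventually_elim simp
      next
        assume "filterlim (\<lambda>u. regs (C u) i) at_bot (before r s)"
        then have "\<forall>\<^sub>F u in before r s. regs (C u) i < -1"
          by (simp add: filterlim_at_bot_dense)
        then show ?thesis by eventually_elim simp
      qed
      moreover have "\<forall>\<^sub>F u in before r s. lt s0 u \<and> lt u s"
        unfolding eventually_before[OF s] using that(2) by blast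
      ultimately have "\<forall>\<^sub>F u in before r s. lt s0 u \<and> lt u s \<and> \<bar>regs (C u) i\<bar> > 1"
        by eventually_elim simp
      then show ?thesis
        using before_ne_bot[OF s] eventually_happens by blast
    qed
    consider "((\<lambda>u. regs (C u) i) \<longlongrightarrow> regs (C t) i) (before r t)"
      | "\<forall>\<^sub>F s in before r t. regs (C s) i \<noteq> 0"
    proof (cases "((\<lambda>u. regs (C u) i) \<longlongrightarrow> regs (C t) i) (before r t)")
      case False
      have "\<forall>\<^sub>F s in before r t. regs (C s) i \<noteq> 0"
        using witbm_rule_diverges(2)[OF C_lim(2)[OF t] False]
      proof
        assume "filterlim (\<lambda>u. regs (C u) i) at_top (before r t)"
        then have "\<forall>\<^sub>F u in before r t. regs (C u) i > 0"
          by (simp add: filterlim_at_top_dense)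
        then show ?thesis by eventually_elim simp
      next
        assume "filterlim (\<lambda>u. regs (C u) i) at_bot (before r t)"
        then have "\<forall>\<^sub>F u in before r t. regs (C u) i < 0"
          by (simp add: filterlim_at_bot_dense)
        then show ?thesis by eventually_elim simp
      qed
      then show ?thesis using that by blast
    qed (use that in blast)
    then show ?thesis
    proof cases
      case 1
      \<comment> \<open>A reset value 0 and the earlier values of modulus above 1 differ by more
        than 1, so they cannot all lie within \<open>1 / 2\<close> of the limit.\<close>
      then have "\<forall>\<^sub>F s in before r t. dist (regs (C s) i) (regs (C t) i) < 1 / 2"
        by (intro tendstoD) auto
      then obtain s0 where s0: "lt s0 t"
        "\<And>s. lt s0 s \<Longrightarrow> lt s t \<Longrightarrow> dist (regs (C s) i) (regs (C t) i) < 1 / 2"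
        unfolding eventually_before[OF t] by blast
      have "\<not> reset s i" if between: "lt s0 s" "lt s t" for s
      proof
        assume s: "reset s i"
        obtain u where "lt s0 u" "lt u s" "\<bar>regs (C u) i\<bar> > 1"
          using big[OF s between(1)] by blast
        then show False
          using s0(2)[OF between] s0(2)[of u] lt_trans[OF _ between(2)] reset0[OF s]
          by (fastforce simp: dist_real_def abs_if split: if_splits)
      qed
      then show ?thesis
        unfolding eventually_before[OF t] using s0(1) by blast
    next
      \<comment> \<open>Here the register is eventually nonzero, whereas a reset makes it 0.\<close>
      case 2
      then show ?thesis by eventually_elim (use reset0 in blast)
    qed
  qed
  \<comment> \<open>Only \<open>reg_a\<close> could differ, and it does so only at resets.\<close>
  have \<rho>_eq: "\<forall>\<^sub>F s in before r t. \<rho> s l = G s l" if t: "limit_time r t" for t l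
  proof (cases l rule: reg_cases)
    case (2 i)
    show ?thesis
      using not_reset[OF t, of i] by eventually_elim (simp add: 2 \<rho>_def G_def encoding_def A_def)
  qed (simp_all add: \<rho>_def G_def encoding_def A_def B_def)
  \<comment> \<open>At a reset both coordinates tend to 0, which is the pair stored in
    \<open>\<rho> t\<close>; otherwise continuity of the coordinates suffices.\<close>
  have G_lim: "((\<lambda>s. G s l) \<longlongrightarrow> \<rho> t l) (before r t)" if t: "limit_time r t" for t l
  proof -
    have b: "((\<lambda>s. B s i) \<longlongrightarrow> B t i) (before r t)" for i
    proof (cases "reset t i")
      case True
      then have "((\<lambda>s. coord_b (regs (C s) i)) \<longlongrightarrow> 0) (before r t)"
        unfolding reset_def
        using tendsto_coords_diverges(2) witbm_rule_diverges(2)[OF C_lim(2)[OF t]] by blast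
      then show ?thesis
        by (simp add: B_def reset0[OF True])
    next
      case False
      then show ?thesis
        using t tendsto_coords(2) by (auto simp: B_def reset_def)
    qed
    have a: "((\<lambda>s. if i < n then coord_a (regs (C s) i) else 0) \<longlongrightarrow> A t i) (before r t)" for i
    proof (cases "reset t i")
      case True
      then have "((\<lambda>s. coord_a (regs (C s) i)) \<longlongrightarrow> 0) (before r t)"
        unfolding reset_def
        using tendsto_coords_diverges(1) witbm_rule_diverges(2)[OF C_lim(2)[OF t]] by blast
      then show ?thesis
        by (simp add: A_def True)
    next
      case False
      then show ?thesis
        using t tendsto_coords(1) by (auto simp: A_def reset_def)
    qed
    show ?thesis
      by (cases l rule: reg_cases) (use a b in \<open>simp_all add: G_def encoding_def \<rho>_def flip: B_def\<close>)
  qed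

  show ?thesis
  proof (rule computation_of_traces[where r = r and tr = tr and T = T])
    fix t assume lim: "limit_time r t" and t: "t \<in> Field r"
    have ge: "\<forall>\<^sub>F s in before r t. pc (C t) \<le> pc (C s)"
    proof (cases "pc (C t)")
      case (Suc j)
      then have "enat j < Liminf (before r t) (\<lambda>s. enat (pc (C s)))"
        using C_lim(1)[OF lim] by (metis enat_ord_simps(2) lessI)
      from less_LiminfD[OF this] show ?thesis
        by eventually_elim (simp add: Suc)
    qed simp
    have mono: "base P k \<le> base P l" if "k \<le> l" for k l
      using that by (simp add: base_def min_le_iff_disj)
    show "\<forall>\<^sub>F s in before r t. \<forall>S \<in> set (tr s). pc (hd (tr t)) \<le> pc S"
      using ge tr_block[OF lim]
    proof eventually_elim
      case (elim s)
      then show ?case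
        using le_trans[OF mono[OF elim(1)]] by (simp add: hd_tr[OF t] start_lim[OF lim])
    qed
    have "\<exists>\<^sub>F s in before r t. pc (C s) = pc (C t)"
      using Liminf_attained[OF lim C_lim(1)[OF lim]] .
    \<comment> \<open>At such \<open>s\<close> the trace begins at the very block entry where the
      trace of \<open>t\<close> begins.\<close>
    from frequently_eventually_frequently[OF this block[OF lim]]
    show "\<exists>\<^sub>F s in before r t. \<exists>S \<in> set (tr s). pc S \<le> pc (hd (tr t))"
    proof (rule frequently_elim1)
      fix s assume s: "pc (C s) = pc (C t) \<and> s \<in> Field r \<and> underS r s \<noteq> {} \<and>
        (\<exists>u. pred_time r s u \<and> lt u t)"
      then have "hd (tr s) \<in> set (tr s)" using tr_ne by simp
      moreover have "pc (hd (tr s)) \<le> pc (hd (tr t))"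
        using s by (simp add: hd_tr t start_lim[OF lim]) (simp add: start_def)
      ultimately show "\<exists>S \<in> set (tr s). pc S \<le> pc (hd (tr t))" ..
    qed
    fix l and e :: real assume e: "0 < e"
    have near: "\<forall>\<^sub>F s in before r t. dist (G s l) (\<rho> t l) < e"
      using G_lim[OF lim] e by (rule tendstoD)
    \<comment> \<open>The trace of \<open>s\<close> also takes values for the successor
      \<open>u\<close>, which lies past the same bound as \<open>s\<close> and is therefore equally
      near.\<close>
    then have "\<forall>\<^sub>F s in before r t. \<forall>u. pred_time r s u \<and> lt u t \<longrightarrow> dist (G u l) (\<rho> t l) < e"
      unfolding eventually_before[OF lim] using lt_trans by (metis pred_time_lt)
    then show "\<forall>\<^sub>F s in before r t. \<forall>S \<in> set (tr s). dist (regs S l) (regs (hd (tr t)) l) < e"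
      using near \<rho>_eq[OF lim, of l] tr_block[OF lim]
    proof eventually_elim
      case (elim s)
      show ?case
      proof
        fix S assume "S \<in> set (tr s)"
        then obtain u where u: "pred_time r s u" "lt u t" "regs S l \<in> {\<rho> s l, G s l, G u l}"
          using elim(4) by blast
        then show "dist (regs S l) (regs (hd (tr t)) l) < e"
          using elim(1-3) by (auto simp: hd_tr[OF t] start_lim[OF lim])
      qed
    qed
  next
    fix s t assume "pred_time r s t"
    then show "step (compile P) (last (tr s)) (hd (tr t))"
      using tr[of s] hd_tr[of t] lt_Field[of s t] by (auto simp: trace_def pred_time_lt)
  qed (use wo tr T in \<open>auto simp: trace_def start_def\<close>)
qed

theorem lemma6:
  fixes f :: "real \<Rightarrow> real"
  shows "ITBM_computable f \<longleftrightarrow> WITBM_computable f"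
proof
  assume "ITBM_computable f"
  moreover have "halts_with witbm_rule P x y" if "halts_with itbm_rule P x y" for P x y
    using that unfolding halts_with_def halting_computation_def computation_def
      itbm_rule_def witbm_rule_def by blast
  ultimately show "WITBM_computable f"
    unfolding ITBM_computable_def WITBM_computable_def by blast
next
  assume "WITBM_computable f"
  then show "ITBM_computable f"
    unfolding ITBM_computable_def WITBM_computable_def
    using bss_compile halts_with_compile by blast
qed

end
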